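(* Let $R\in\mathcal{T}_n$ ($n>1$). Then: (1) $\mathcal{D}(R)$ satisfies a polynomial identity (PI) if and only if $R$ does so. (2) If $\mathcal{D}(R)$ is commutative, then $R$ satisfies $(xy-yx)^n=0$ for all $x,y\in R$. (3) $\mathcal{D}(R)$ is almost PI if and only if $R$ is almost PI. (4) If $\mathcal{D}(R)$ is intrinsically PI, then $R$ is intrinsically PI.
   Context: All rings are associative with unity and modules are unital. An $n$-by-$n$ generalized matrix ring is a square array with rings $R_i$ on the diagonal and $(R_i,R_j)$-bimodules $M_{ij}$ in the $(i,j)$-positions ($i\neq j$, $M_{ii}=R_i$), together with $(R_i,R_k)$-bimodule homomorphisms $\theta_{ijk}:M_{ij}\otimes_{R_j}M_{jk}\to M_{ik}$, written $m_{ij}m_{jk}=\theta_{ijk}(m_{ij}\otimes m_{jk})$, satisfying $(m_{ij}m_{jk})m_{kl}=m_{ij}(m_{jk}m_{kl})$ for all indices; $\theta_{iii}$ is the multiplication of $R_i$, and $\theta_{ijj},\theta_{jjk}$ are the scalar multiplications. Addition is componentwise and multiplication is row-column matrix multiplication. For $n>1$, $\mathcal{T}_n$ is the class of $n$-by-$n$ generalized matrix rings with $\theta_{iji}=0$ for all $i\neq j$. $\mathcal{D}(R)=\{[r_{ij}]\in R\mid r_{ij}=0\text{ for all } i\neq j\}$. A PI-ring is a ring satisfying a polynomial identity (in the usual sense). A ring is almost PI if every prime factor ring of it is a PI-ring. A ring $R$ is intrinsically PI if every nonzero ideal of $R$ contains a nonzero PI-ideal of $R$, i.e. a nonzero ideal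 of $R$ which satisfies a polynomial identity as a ring (possibly without unity). *)

theory Defs
  imports "HOL-Algebra.QuotRing" "HOL-Algebra.Ideal_Product" "HOL-Library.Poly_Mapping"
begin

section \<open>Generalized matrix rings\<close>

text \<open>
  Abelian groups are given by records of type \<^typ>\<open>'a ring\<close>, as usual for \<^locale>\<open>abelian_group\<close>;
  their multiplication and unit are irrelevant. The library's modules are over commutative rings,
  hence the following locale.
\<close>

locale bimodule =
  R: ring R + S: ring S + M: abelian_group M
  for R :: "'a ring" and S :: "'b ring" and M :: "'c ring" +
  fixes lmul :: "'a \<Rightarrow> 'c \<Rightarrow> 'c" and rmul :: "'c \<Rightarrow> 'b \<Rightarrow> 'c"
  assumes lmul_closed: "\<lbrakk>r \<in> carrier R; x \<in> carrier M\<rbrakk> \<Longrightarrow> lmul r x \<in> carrier M"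
    and lmul_add_left: "\<lbrakk>r \<in> carrier R; r' \<in> carrier R; x \<in> carrier M\<rbrakk>
      \<Longrightarrow> lmul (r \<oplus>\<^bsub>R\<^esub> r') x = lmul r x \<oplus>\<^bsub>M\<^esub> lmul r' x"
    and lmul_add_right: "\<lbrakk>r \<in> carrier R; x \<in> carrier M; y \<in> carrier M\<rbrakk>
      \<Longrightarrow> lmul r (x \<oplus>\<^bsub>M\<^esub> y) = lmul r x \<oplus>\<^bsub>M\<^esub> lmul r y"
    and lmul_assoc: "\<lbrakk>r \<in> carrier R; r' \<in> carrier R; x \<in> carrier M\<rbrakk>
      \<Longrightarrow> lmul (r \<otimes>\<^bsub>R\<^esub> r') x = lmul r (lmul r' x)"
    and lmul_one: "x \<in> carrier M \<Longrightarrow> lmul \<one>\<^bsub>R\<^esub> x = x"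
    and rmul_closed: "\<lbrakk>x \<in> carrier M; s \<in> carrier S\<rbrakk> \<Longrightarrow> rmul x s \<in> carrier M"
    and rmul_add_left: "\<lbrakk>x \<in> carrier M; y \<in> carrier M; s \<in> carrier S\<rbrakk>
      \<Longrightarrow> rmul (x \<oplus>\<^bsub>M\<^esub> y) s = rmul x s \<oplus>\<^bsub>M\<^esub> rmul y s"
    and rmul_add_right: "\<lbrakk>x \<in> carrier M; s \<in> carrier S; s' \<in> carrier S\<rbrakk>
      \<Longrightarrow> rmul x (s \<oplus>\<^bsub>S\<^esub> s') = rmul x s \<oplus>\<^bsub>M\<^esub> rmul x s'"
    and rmul_assoc: "\<lbrakk>x \<in> carrier M; s \<in> carrier S; s' \<in> carrier S\<rbrakk>
      \<Longrightarrow> rmul x (s \<otimes>\<^bsub>S\<^esub> s') = rmul (rmul x s) s'"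
    and rmul_one: "x \<in> carrier M \<Longrightarrow> rmul x \<one>\<^bsub>S\<^esub> = x"
    and lmul_rmul: "\<lbrakk>r \<in> carrier R; x \<in> carrier M; s \<in> carrier S\<rbrakk>
      \<Longrightarrow> rmul (lmul r x) s = lmul r (rmul x s)"

text \<open>
  The diagonal ring \<open>R\<^sub>i\<close> is \<open>M i i\<close>. A bimodule homomorphism out of the tensor product
  \<open>M\<^sub>i\<^sub>j \<otimes> M\<^sub>j\<^sub>k\<close> over \<open>R\<^sub>j\<close> is rendered, via the universal property, as the map
  \<open>\<theta> i j k\<close> that is additive in each argument, balanced over \<open>R\<^sub>j\<close>, and linear over \<open>R\<^sub>i\<close> on the
  left and over \<open>R\<^sub>k\<close> on the right. As \<open>\<theta> i i j\<close> and \<open>\<theta> i j j\<close> are the scalar multiplications, the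
  last three conditions are the instances \<open>j = k\<close>, \<open>i = j\<close> and \<open>k = l\<close> of associativity.
\<close>

locale generalized_matrix_ring =
  fixes n :: nat
    and M :: "nat \<Rightarrow> nat \<Rightarrow> 'a ring"
    and \<theta> :: "nat \<Rightarrow> nat \<Rightarrow> nat \<Rightarrow> 'a \<Rightarrow> 'a \<Rightarrow> 'a"
  assumes diag_ring: "i \<in> {1..n} \<Longrightarrow> ring (M i i)"
    and diag_mult: "\<lbrakk>i \<in> {1..n}; x \<in> carrier (M i i); y \<in> carrier (M i i)\<rbrakk>
      \<Longrightarrow> \<theta> i i i x y = x \<otimes>\<^bsub>M i i\<^esub> y"
    and off_diag_bimodule: "\<lbrakk>i \<in> {1..n}; j \<in> {1..n}; i \<noteq> j\<rbrakk>
      \<Longrightarrow> bimodule (M i i) (M j j) (M i j) (\<theta> i i j) (\<theta> i j j)"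
    and theta_closed: "\<lbrakk>i \<in> {1..n}; j \<in> {1..n}; k \<in> {1..n};
        x \<in> carrier (M i j); y \<in> carrier (M j k)\<rbrakk>
      \<Longrightarrow> \<theta> i j k x y \<in> carrier (M i k)"
    and theta_add_left: "\<lbrakk>i \<in> {1..n}; j \<in> {1..n}; k \<in> {1..n};
        x \<in> carrier (M i j); x' \<in> carrier (M i j); y \<in> carrier (M j k)\<rbrakk>
      \<Longrightarrow> \<theta> i j k (x \<oplus>\<^bsub>M i j\<^esub> x') y = \<theta> i j k x y \<oplus>\<^bsub>M i k\<^esub> \<theta> i j k x' y"
    and theta_add_right: "\<lbrakk>i \<in> {1..n}; j \<in> {1..n}; k \<in> {1..n};
        x \<in> carrier (M i j); y \<in> carrier (M j k); y' \<in> carrier (M j k)\<rbrakk>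
      \<Longrightarrow> \<theta> i j k x (y \<oplus>\<^bsub>M j k\<^esub> y') = \<theta> i j k x y \<oplus>\<^bsub>M i k\<^esub> \<theta> i j k x y'"
    and theta_assoc: "\<lbrakk>i \<in> {1..n}; j \<in> {1..n}; k \<in> {1..n}; l \<in> {1..n};
        x \<in> carrier (M i j); y \<in> carrier (M j k); z \<in> carrier (M k l)\<rbrakk>
      \<Longrightarrow> \<theta> i k l (\<theta> i j k x y) z = \<theta> i j l x (\<theta> j k l y z)"

definition matrix_ring ::
  "nat \<Rightarrow> (nat \<Rightarrow> nat \<Rightarrow> 'a ring) \<Rightarrow> (nat \<Rightarrow> nat \<Rightarrow> nat \<Rightarrow> 'a \<Rightarrow> 'a \<Rightarrow> 'a) \<Rightarrow> (nat \<times> nat \<Rightarrow> 'a) ring"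
  where
  "matrix_ring n M \<theta> =
    \<lparr> carrier = (\<Pi>\<^sub>E (i, j) \<in> {1..n} \<times> {1..n}. carrier (M i j)),
      mult = (\<lambda>A B. \<lambda>(i, k) \<in> {1..n} \<times> {1..n}.
                \<Oplus>\<^bsub>M i k\<^esub>j\<in>{1..n}. \<theta> i j k (A (i, j)) (B (j, k))),
      one = (\<lambda>(i, j) \<in> {1..n} \<times> {1..n}. if i = j then \<one>\<^bsub>M i j\<^esub> else \<zero>\<^bsub>M i j\<^esub>),
      zero = (\<lambda>(i, j) \<in> {1..n} \<times> {1..n}. \<zero>\<^bsub>M i j\<^esub>),
      add = (\<lambda>A B. \<lambda>(i, j) \<in> {1..n} \<times> {1..n}. A (i, j) \<oplus>\<^bsub>M i j\<^esub> B (i, j)) \<rparr>"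

text \<open>The class \<open>\<T>\<^sub>n\<close>.\<close>

locale trivial_generalized_matrix_ring = generalized_matrix_ring +
  assumes n_gt_1: "n > 1"
    and theta_zero: "\<lbrakk>i \<in> {1..n}; j \<in> {1..n}; i \<noteq> j; x \<in> carrier (M i j); y \<in> carrier (M j i)\<rbrakk>
      \<Longrightarrow> \<theta> i j i x y = \<zero>\<^bsub>M i i\<^esub>"

definition diagonal_ring ::
  "nat \<Rightarrow> (nat \<Rightarrow> nat \<Rightarrow> 'a ring) \<Rightarrow> (nat \<Rightarrow> nat \<Rightarrow> nat \<Rightarrow> 'a \<Rightarrow> 'a \<Rightarrow> 'a) \<Rightarrow> (nat \<times> nat \<Rightarrow> 'a) ring"
  where
  "diagonal_ring n M \<theta> =
    (matrix_ring n M \<theta>) \<lparr> carrier :=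
      {A \<in> carrier (matrix_ring n M \<theta>). \<forall>i\<in>{1..n}. \<forall>j\<in>{1..n}. i \<noteq> j \<longrightarrow> A (i, j) = \<zero>\<^bsub>M i j\<^esub>} \<rparr>"


section \<open>Polynomial identities\<close>

text \<open>
  A polynomial in noncommuting variables \<open>x\<^sub>0, x\<^sub>1, \<dots>\<close> over the integers is a finitely supported map
  from words to integers. Words of length 0 are excluded below, so that polynomials can be
  evaluated in rings without unity; for a ring with unity this is no restriction, since the
  constant term of an identity is itself zero in the ring (substitute 0 for all variables). Evaluation does not use
  \<open>\<one>\<close>, so it makes sense for an ideal \<open>I\<close>, i.e. for \<open>R\<lparr>carrier := I\<rparr>\<close>.
\<close>

type_synonym nc_poly = "nat list \<Rightarrow>\<^sub>0 int"

fun word_eval :: "('a, 'b) ring_scheme \<Rightarrow> (nat \<Rightarrow> 'a) \<Rightarrow> nat list \<Rightarrow> 'a" where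
  "word_eval R a [x] = a x"
| "word_eval R a (x # y # w) = a x \<otimes>\<^bsub>R\<^esub> word_eval R a (y # w)"

definition nc_poly_eval :: "('a, 'b) ring_scheme \<Rightarrow> (nat \<Rightarrow> 'a) \<Rightarrow> nc_poly \<Rightarrow> 'a" where
  "nc_poly_eval R a f = (\<Oplus>\<^bsub>R\<^esub>w\<in>Poly_Mapping.keys f. [Poly_Mapping.lookup f w] \<cdot>\<^bsub>R\<^esub> word_eval R a w)"

text \<open>
  The usual nondegeneracy condition: some monomial of highest degree has coefficient 1. (Merely
  requiring \<open>f \<noteq> 0\<close> would make every ring of positive characteristic PI.)
\<close>

definition nc_monic :: "nc_poly \<Rightarrow> bool" where
  "nc_monic f \<longleftrightarrow> (\<exists>w\<in>Poly_Mapping.keys f. Poly_Mapping.lookup f w = 1 \<and> (\<forall>v\<in>Poly_Mapping.keys f. length v \<le> length w))"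

definition satisfies_PI :: "('a, 'b) ring_scheme \<Rightarrow> bool" where
  "satisfies_PI R \<longleftrightarrow>
    (\<exists>f. [] \<notin> Poly_Mapping.keys f \<and> nc_monic f \<and>
      (\<forall>a. (\<forall>x. a x \<in> carrier R) \<longrightarrow> nc_poly_eval R a f = \<zero>\<^bsub>R\<^esub>))"

text \<open>The library's \<^locale>\<open>primeideal\<close> is the notion for commutative rings.\<close>

definition prime_ring :: "('a, 'b) ring_scheme \<Rightarrow> bool" where
  "prime_ring R \<longleftrightarrow> ring R \<and> carrier R \<noteq> {\<zero>\<^bsub>R\<^esub>} \<and>
    (\<forall>I J. ideal I R \<longrightarrow> ideal J R \<longrightarrow> I \<cdot>\<^bsub>R\<^esub> J = {\<zero>\<^bsub>R\<^esub>} \<longrightarrow> I = {\<zero>\<^bsub>R\<^esub>} \<or> J = {\<zero>\<^bsub>R\<^esub>})"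

definition almost_PI :: "('a, 'b) ring_scheme \<Rightarrow> bool" where
  "almost_PI R \<longleftrightarrow> (\<forall>P. ideal P R \<longrightarrow> prime_ring (R Quot P) \<longrightarrow> satisfies_PI (R Quot P))"

definition intrinsically_PI :: "('a, 'b) ring_scheme \<Rightarrow> bool" where
  "intrinsically_PI R \<longleftrightarrow>
    (\<forall>I. ideal I R \<longrightarrow> I \<noteq> {\<zero>\<^bsub>R\<^esub>} \<longrightarrow>
      (\<exists>J. ideal J R \<and> J \<subseteq> I \<and> J \<noteq> {\<zero>\<^bsub>R\<^esub>} \<and> satisfies_PI (R\<lparr>carrier := J\<rparr>)))"

end

theory Submission
  imports Defs "HOL-Algebra.UnivPoly" "HOL-Algebra.Subrings"
begin

text \<open>
  Let \<open>R \<in> \<T>\<^sub>n\<close> with diagonal \<open>D\<close>, and let \<open>J\<close> be the set of matrices with zero diagonal. Because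
  \<open>\<theta>\<^sub>i\<^sub>j\<^sub>i = 0\<close> for \<open>i \<noteq> j\<close>, the diagonal entries of a product of two matrices are the products of their
  diagonal entries. Hence forgetting the entries off the diagonal is a surjective ring homomorphism
  \<open>R \<rightarrow> D\<close> with kernel \<open>J\<close> (\<open>diag_ring_hom\<close>). Moreover \<open>J\<^sup>n = 0\<close>: an entry of a product of \<open>n\<close> matrices from
  \<open>J\<close> is a sum of products along paths \<open>i\<^sub>0, \<dots>, i\<^sub>n\<close> in \<open>{1..n}\<close>. Paths with
  two equal neighbours contribute nothing, because the diagonals are zero. On any other path some index
  occurs twice, and the part of the product between the two occurrences is a value of some \<open>\<theta>\<^sub>i\<^sub>j\<^sub>i\<close> with
  \<open>i \<noteq> j\<close>, hence zero (\<open>kernel_diag_nilpotent\<close>).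

  Everything else holds for any surjective homomorphism \<open>h : R \<rightarrow> S\<close> whose kernel \<open>K\<close> satisfies \<open>K\<^sup>n = 0\<close>
  (locale \<open>nilpotent_extension\<close>). If \<open>f\<close> is an identity of \<open>S\<close>, then \<open>f\<^sup>n\<close> is one of \<open>R\<close>, and identities pass
  to homomorphic images. If \<open>S\<close> is commutative, commutators of \<open>R\<close> lie in \<open>K\<close>, so their \<open>n\<close>-th powers vanish. Prime ideals of \<open>R\<close> contain
  the nilpotent ideal \<open>K\<close>, so \<open>R\<close> and \<open>S\<close> have the same prime factor rings. Finally, a nonzero ideal \<open>I\<close> of
  \<open>R\<close> either meets \<open>K\<close> in a nonzero nilpotent ideal, or is mapped isomorphically to an ideal of \<open>S\<close>, in
  which case a PI-ideal below \<open>h(I)\<close> can be pulled back.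
\<close>

section \<open>Evaluation of noncommutative polynomials\<close>

abbreviation "keys \<equiv> Poly_Mapping.keys"
abbreviation "lookup \<equiv> Poly_Mapping.lookup"

context ring
begin

lemma foldr_mult_closed: "set xs \<subseteq> carrier R \<Longrightarrow> foldr (\<otimes>) xs \<one> \<in> carrier R"
  by (induction xs) auto

lemma foldr_mult_append:
  "\<lbrakk>set xs \<subseteq> carrier R; set ys \<subseteq> carrier R\<rbrakk>
    \<Longrightarrow> foldr (\<otimes>) (xs @ ys) \<one> = foldr (\<otimes>) xs \<one> \<otimes> foldr (\<otimes>) ys \<one>"
  by (induction xs) (auto simp: m_assoc foldr_mult_closed simp del: foldr_append)

lemma foldr_mult_replicate:
  "x \<in> carrier R \<Longrightarrow> foldr (\<otimes>) (replicate k x) \<one> = x [^] k"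
  by (induction k) (simp_all add: nat_pow_Suc2[unfolded nat_pow_Suc] del: foldr_replicate)

lemma word_eval_eq_foldr:
  "\<lbrakk>range a \<subseteq> carrier R; w \<noteq> []\<rbrakk> \<Longrightarrow> word_eval R a w = foldr (\<otimes>) (map a w) \<one>"
proof (induction w)
  case (Cons x w)
  then show ?case by (cases w) (auto simp: image_subset_iff)
qed simp

lemma word_eval_closed:
  "\<lbrakk>range a \<subseteq> carrier R; w \<noteq> []\<rbrakk> \<Longrightarrow> word_eval R a w \<in> carrier R"
  using foldr_mult_closed[of "map a w"] by (auto simp: word_eval_eq_foldr image_subset_iff)

lemma word_eval_append:
  assumes "range a \<subseteq> carrier R" "u \<noteq> []" "v \<noteq> []"
  shows "word_eval R a (u @ v) = word_eval R a u \<otimes> word_eval R a v"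
  using assms foldr_mult_append[of "map a u" "map a v"]
  by (simp add: word_eval_eq_foldr image_subset_iff)

lemma monomial_closed:
  "\<lbrakk>range a \<subseteq> carrier R; w \<noteq> []\<rbrakk> \<Longrightarrow> [(c :: int)] \<cdot> word_eval R a w \<in> carrier R"
  by (simp add: word_eval_closed)

lemma nc_poly_eval_closed:
  "\<lbrakk>range a \<subseteq> carrier R; [] \<notin> keys f\<rbrakk> \<Longrightarrow> nc_poly_eval R a f \<in> carrier R"
  unfolding nc_poly_eval_def by (intro finsum_closed Pi_I monomial_closed) auto

lemma nc_poly_eval_superset:
  assumes a: "range a \<subseteq> carrier R" and S: "finite S" "keys f \<subseteq> S" "[] \<notin> S"
  shows "nc_poly_eval R a f = (\<Oplus>w\<in>S. [lookup f w] \<cdot> word_eval R a w)"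
  unfolding nc_poly_eval_def
proof (rule add.finprod_mono_neutral_cong_left)
  show "[lookup f w] \<cdot> word_eval R a w = \<zero>" if "w \<in> S - keys f" for w
    using that by (simp add: in_keys_iff add_pow_def)
  show "(\<lambda>w. [lookup f w] \<cdot> word_eval R a w) \<in> S \<rightarrow> carrier R"
    using S(3) by (intro Pi_I monomial_closed[OF a]) auto
qed (use S in auto)

lemma nc_poly_eval_add:
  assumes a: "range a \<subseteq> carrier R" and f: "[] \<notin> keys f" and g: "[] \<notin> keys g"
  shows "nc_poly_eval R a (f + g) = nc_poly_eval R a f \<oplus> nc_poly_eval R a g"
proof -
  let ?S = "keys f \<union> keys g"
  have S: "[] \<notin> ?S" "finite ?S" using f g by auto
  have ne: "w \<noteq> []" if "w \<in> ?S" for w using that S by metis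
  have "nc_poly_eval R a (f + g) = (\<Oplus>w\<in>?S. [lookup (f + g) w] \<cdot> word_eval R a w)"
    by (rule nc_poly_eval_superset) (use a S keys_add[of f g] in auto)
  also have "\<dots> = (\<Oplus>w\<in>?S. [lookup f w] \<cdot> word_eval R a w \<oplus> [lookup g w] \<cdot> word_eval R a w)"
  proof (rule finsum_cong')
    fix w assume "w \<in> ?S"
    then show "[lookup (f + g) w] \<cdot> word_eval R a w
        = [lookup f w] \<cdot> word_eval R a w \<oplus> [lookup g w] \<cdot> word_eval R a w"
      using word_eval_closed[OF a ne] by (simp add: lookup_add add.int_pow_mult)
  qed (use a ne monomial_closed in auto)
  also have "\<dots> = nc_poly_eval R a f \<oplus> nc_poly_eval R a g"
    using a S ne by (subst finsum_addf)
      (auto simp: nc_poly_eval_superset[of a ?S] intro!: monomial_closed)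
  finally show ?thesis .
qed

lemma nc_poly_eval_zero: "nc_poly_eval R a 0 = \<zero>"
  by (simp add: nc_poly_eval_def)

lemma nc_poly_eval_sum:
  assumes a: "range a \<subseteq> carrier R" and "finite I" and f: "\<And>i. i \<in> I \<Longrightarrow> [] \<notin> keys (f i)"
  shows "nc_poly_eval R a (\<Sum>i\<in>I. f i) = (\<Oplus>i\<in>I. nc_poly_eval R a (f i))"
  using assms(2) f
proof (induction I rule: finite_induct)
  case (insert i I)
  moreover have "[] \<notin> keys (\<Sum>i\<in>I. f i)"
    using insert.prems keys_sum[of f I] by auto
  ultimately show ?case
    using a by (simp add: nc_poly_eval_add nc_poly_eval_closed Pi_def)
qed (simp add: nc_poly_eval_zero)

lemma nc_poly_eval_single:
  assumes "range a \<subseteq> carrier R" "w \<noteq> []"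
  shows "nc_poly_eval R a (Poly_Mapping.single w c) = [c] \<cdot> word_eval R a w"
  using assms by (subst nc_poly_eval_superset[of a "{w}"]) (auto simp: finsum_singleton word_eval_closed)

end

section \<open>Products of noncommutative polynomials\<close>

text \<open>
  This is the product of the free ring: concatenation of words, extended bilinearly.
\<close>

definition nc_times :: "nc_poly \<Rightarrow> nc_poly \<Rightarrow> nc_poly" where
  "nc_times f g = (\<Sum>u\<in>keys f. \<Sum>v\<in>keys g. Poly_Mapping.single (u @ v) (lookup f u * lookup g v))"

lemma keys_nc_timesE:
  assumes "w \<in> keys (nc_times f g)"
  obtains u v where "u \<in> keys f" "v \<in> keys g" "w = u @ v"
proof -
  have "w \<in> (\<Union>u\<in>keys f. \<Union>v\<in>keys g.
      keys (Poly_Mapping.single (u @ v) (lookup f u * lookup g v)))"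
    using subsetD[OF keys_sum assms[unfolded nc_times_def]]
    by (auto dest!: subsetD[OF keys_sum] simp del: keys_single)
  then obtain u v where uv: "u \<in> keys f" "v \<in> keys g"
    and "w \<in> keys (Poly_Mapping.single (u @ v) (lookup f u * lookup g v))"
    by (elim UN_E)
  then have "w = u @ v" by (simp split: if_splits)
  with uv show ?thesis by (rule that)
qed

lemma Nil_notin_keys_nc_times: "[] \<notin> keys f \<Longrightarrow> [] \<notin> keys (nc_times f g)"
  by (auto elim: keys_nc_timesE)

text \<open>
  Words of maximal length factor uniquely: if \<open>u\<^sub>0\<close> and \<open>v\<^sub>0\<close> are leading words of the two factors,
  then comparing lengths shows that \<open>u\<^sub>0 @ v\<^sub>0\<close> arises from no other pair of words, so that its
  coefficient is 1 and no cancellation can occur.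
\<close>

lemma nc_monic_nc_times:
  assumes "nc_monic f" "nc_monic g"
  shows "nc_monic (nc_times f g)"
proof -
  obtain u0 where u0: "u0 \<in> keys f" "lookup f u0 = 1" "\<And>u. u \<in> keys f \<Longrightarrow> length u \<le> length u0"
    using assms(1) unfolding nc_monic_def by blast
  obtain v0 where v0: "v0 \<in> keys g" "lookup g v0 = 1" "\<And>v. v \<in> keys g \<Longrightarrow> length v \<le> length v0"
    using assms(2) unfolding nc_monic_def by blast
  have split: "u @ v = u0 @ v0 \<longleftrightarrow> u = u0 \<and> v = v0" if "u \<in> keys f" "v \<in> keys g" for u v
  proof
    assume eq: "u @ v = u0 @ v0"
    then have "length u + length v = length u0 + length v0"
      by (metis length_append)
    then have "length u = length u0"
      using u0(3)[OF that(1)] v0(3)[OF that(2)] by linarith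
    with eq show "u = u0 \<and> v = v0" by simp
  qed simp
  have "lookup (nc_times f g) (u0 @ v0)
      = (\<Sum>u\<in>keys f. \<Sum>v\<in>keys g. if u = u0 \<and> v = v0 then lookup f u * lookup g v else 0)"
    unfolding nc_times_def lookup_sum
    by (intro sum.cong refl) (auto simp: lookup_single when_def split)
  also have "\<dots> = (\<Sum>u\<in>keys f. if u = u0 then \<Sum>v\<in>keys g. if v = v0 then lookup f u * lookup g v else 0 else 0)"
    by (intro sum.cong refl) auto
  also have "\<dots> = 1"
    using u0 v0 by simp
  finally have 1: "lookup (nc_times f g) (u0 @ v0) = 1" .
  moreover have "length w \<le> length (u0 @ v0)" if "w \<in> keys (nc_times f g)" for w
    using that
  proof (rule keys_nc_timesE)
    fix u v assume "u \<in> keys f" "v \<in> keys g" "w = u @ v"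
    then show ?thesis using u0(3)[of u] v0(3)[of v] by simp
  qed
  ultimately show ?thesis
    unfolding nc_monic_def by (intro bexI[of _ "u0 @ v0"]) (auto simp: in_keys_iff)
qed

lemma (in ring) nc_poly_eval_nc_times:
  assumes a: "range a \<subseteq> carrier R" and f: "[] \<notin> keys f" and g: "[] \<notin> keys g"
  shows "nc_poly_eval R a (nc_times f g) = nc_poly_eval R a f \<otimes> nc_poly_eval R a g"
proof -
  have f': "u \<noteq> []" if "u \<in> keys f" for u using that f by metis
  have g': "v \<noteq> []" if "v \<in> keys g" for v using that g by metis
  let ?m = "\<lambda>h w. [lookup h w] \<cdot> word_eval R a w"
  have mf: "?m f u \<in> carrier R" if "u \<in> keys f" for u
    using monomial_closed[OF a f'[OF that]] .
  have mg: "?m g v \<in> carrier R" if "v \<in> keys g" for v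
    using monomial_closed[OF a g'[OF that]] .
  have term_eq: "nc_poly_eval R a (Poly_Mapping.single (u @ v) (lookup f u * lookup g v))
      = ?m f u \<otimes> ?m g v" if "u \<in> keys f" "v \<in> keys g" for u v
    using word_eval_closed[OF a f'[OF that(1)]] word_eval_closed[OF a g'[OF that(2)]]
      f'[OF that(1)] g'[OF that(2)]
    by (simp add: nc_poly_eval_single[OF a] word_eval_append[OF a] add_pow_ldistr_int
        add_pow_rdistr_int add.int_pow_pow mult.commute)
  have inner: "nc_poly_eval R a (\<Sum>v\<in>keys g. Poly_Mapping.single (u @ v) (lookup f u * lookup g v))
      = ?m f u \<otimes> nc_poly_eval R a g" if u: "u \<in> keys f" for u
  proof -
    have "nc_poly_eval R a (\<Sum>v\<in>keys g. Poly_Mapping.single (u @ v) (lookup f u * lookup g v))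
        = (\<Oplus>v\<in>keys g. ?m f u \<otimes> ?m g v)"
      by (subst nc_poly_eval_sum[OF a]) (use u f' mf mg term_eq in \<open>auto intro!: finsum_cong'\<close>)
    also have "\<dots> = ?m f u \<otimes> (\<Oplus>v\<in>keys g. ?m g v)"
      by (rule finsum_rdistr[symmetric]) (use mf[OF u] mg in auto)
    finally show ?thesis by (simp add: nc_poly_eval_def)
  qed
  have "nc_poly_eval R a (nc_times f g) = (\<Oplus>u\<in>keys f. ?m f u \<otimes> nc_poly_eval R a g)"
    unfolding nc_times_def
  proof (subst nc_poly_eval_sum[OF a])
    show "[] \<notin> keys (\<Sum>v\<in>keys g. Poly_Mapping.single (u @ v) (lookup f u * lookup g v))"
      if "u \<in> keys f" for u
      using keys_sum[of "\<lambda>v. Poly_Mapping.single (u @ v) (lookup f u * lookup g v)" "keys g"]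
        f'[OF that] by (auto split: if_splits)
  qed (use inner mf nc_poly_eval_closed[OF a g] in \<open>auto intro!: finsum_cong'\<close>)
  also have "\<dots> = nc_poly_eval R a f \<otimes> nc_poly_eval R a g"
    unfolding nc_poly_eval_def[of R a f]
    by (rule finsum_ldistr[symmetric]) (use mf nc_poly_eval_closed[OF a g] in auto)
  finally show ?thesis .
qed

text \<open>
  The polynomial \<open>nc_power f k\<close> is the power with exponent \<open>k + 1\<close>: the power with exponent 0 would be
  the empty word, which has no value in a ring without unity.
\<close>

fun nc_power :: "nc_poly \<Rightarrow> nat \<Rightarrow> nc_poly" where
  "nc_power f 0 = f"
| "nc_power f (Suc k) = nc_times f (nc_power f k)"

lemma Nil_notin_keys_nc_power: "[] \<notin> keys f \<Longrightarrow> [] \<notin> keys (nc_power f k)"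
  by (cases k) (auto simp: Nil_notin_keys_nc_times)

lemma nc_monic_nc_power: "nc_monic f \<Longrightarrow> nc_monic (nc_power f k)"
  by (induction k) (auto simp: nc_monic_nc_times)

lemma (in ring) nc_poly_eval_nc_power:
  assumes "range a \<subseteq> carrier R" "[] \<notin> keys f"
  shows "nc_poly_eval R a (nc_power f k) = nc_poly_eval R a f [^] Suc k"
proof (induction k)
  case 0
  then show ?case using nc_poly_eval_closed[OF assms] by simp
next
  case (Suc k)
  then show ?case
    using nc_poly_eval_closed[OF assms] nat_pow_Suc2[of "nc_poly_eval R a f" "Suc k"]
    by (simp add: nc_poly_eval_nc_times[OF assms] Nil_notin_keys_nc_power[OF assms(2)])
qed

section \<open>Evaluation under homomorphisms and in ideals\<close>

lemma (in ring_hom_ring) hom_nc_poly_eval: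
  assumes a: "range a \<subseteq> carrier R" and f: "[] \<notin> keys f"
  shows "h (nc_poly_eval R a f) = nc_poly_eval S (h \<circ> a) f"
proof -
  have ha: "range (h \<circ> a) \<subseteq> carrier S" using a by auto
  have ne: "w \<noteq> []" if "w \<in> keys f" for w using that f by metis
  have word: "h (word_eval R a w) = word_eval S (h \<circ> a) w" if "w \<noteq> []" for w
    using that
  proof (induction w rule: list_nonempty_induct)
    case (cons x w)
    then show ?case
      using a R.word_eval_closed[OF a] by (cases w) (auto simp: image_subset_iff)
  qed simp
  have "h (nc_poly_eval R a f) = (\<Oplus>\<^bsub>S\<^esub>w\<in>keys f. h ([lookup f w] \<cdot> word_eval R a w))"
    unfolding nc_poly_eval_def using ne R.monomial_closed[OF a]
    by (subst hom_finsum) (auto simp: comp_def)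
  also have "\<dots> = nc_poly_eval S (h \<circ> a) f"
    unfolding nc_poly_eval_def
  proof (rule S.finsum_cong')
    fix w assume "w \<in> keys f"
    then show "h ([lookup f w] \<cdot> word_eval R a w) = [lookup f w] \<cdot>\<^bsub>S\<^esub> word_eval S (h \<circ> a) w"
      using word ne R.word_eval_closed[OF a]
      by (simp add: add_pow_def group_hom.hom_int_pow[OF a_group_hom])
  qed (use S.monomial_closed[OF ha] ne in auto)
  finally show ?thesis .
qed

text \<open>
  An ideal regarded as a ring in its own right usually lacks a unity and so falls outside \<^locale>\<open>ring\<close>.
  Sums, integer multiples and products of its elements are nevertheless those of the ambient ring, so
  that its polynomial identities can be checked there.
\<close>

lemma (in ring) nc_poly_eval_additive_subgroup:
  assumes J: "additive_subgroup J R" and mult: "\<And>x y. \<lbrakk>x \<in> J; y \<in> J\<rbrakk> \<Longrightarrow> x \<otimes> y \<in> J"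
    and a: "range a \<subseteq> J" and f: "[] \<notin> keys f"
  shows "nc_poly_eval (R\<lparr>carrier := J\<rparr>) a f = nc_poly_eval R a f"
    and "nc_poly_eval R a f \<in> J"
proof -
  interpret J: additive_subgroup J R by fact
  have "comm_group ((add_monoid R)\<lparr>carrier := J\<rparr>)"
    by (rule group.group_comm_groupI[OF add.subgroup_imp_group[OF J.a_subgroup]])
      (auto simp: a_comm J.a_Hcarr)
  then interpret RJ: abelian_group "R\<lparr>carrier := J\<rparr>"
    by (intro comm_group_abelian_groupI) simp
  have ne: "w \<noteq> []" if "w \<in> keys f" for w using that f by metis
  have word: "word_eval (R\<lparr>carrier := J\<rparr>) a w = word_eval R a w \<and> word_eval R a w \<in> J" if "w \<noteq> []" for w
    using that
  proof (induction w rule: list_nonempty_induct)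
    case (cons x w)
    then show ?case
      using a mult by (cases w) auto
  qed (use a in auto)
  have mono: "[c] \<cdot>\<^bsub>R\<lparr>carrier := J\<rparr>\<^esub> word_eval (R\<lparr>carrier := J\<rparr>) a w = [c] \<cdot> word_eval R a w"
    if "w \<noteq> []" for w and c :: int
    using add.int_pow_consistent[OF J.a_subgroup, of "word_eval R a w" c] word[OF that]
    by (simp add: add_pow_def)
  have mono_J: "[c] \<cdot> word_eval R a w \<in> J" if "w \<noteq> []" for w and c :: int
    using RJ.add.int_pow_closed[of "word_eval R a w" c] word[OF that] mono[OF that] by simp
  have fin: "finsum (R\<lparr>carrier := J\<rparr>) g A = finsum R g A" if "finite A" "g \<in> A \<rightarrow> J" for g :: "nat list \<Rightarrow> 'a" and A
    using that
  proof (induction A rule: finite_induct)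
    case empty
    then show ?case using RJ.finsum_empty by simp
  next
    case (insert x A)
    then show ?case
      using RJ.finsum_insert[of A x g] J.a_Hcarr by (auto simp: Pi_def)
  qed
  show eq: "nc_poly_eval (R\<lparr>carrier := J\<rparr>) a f = nc_poly_eval R a f"
    unfolding nc_poly_eval_def
    using fin[of "keys f" "\<lambda>w. [lookup f w] \<cdot> word_eval R a w"] mono mono_J ne
    by (subst RJ.finsum_cong'[OF refl, of "\<lambda>w. [lookup f w] \<cdot> word_eval R a w"]) auto
  have "nc_poly_eval (R\<lparr>carrier := J\<rparr>) a f \<in> carrier (R\<lparr>carrier := J\<rparr>)"
    unfolding nc_poly_eval_def
    by (rule RJ.finsum_closed) (use mono mono_J ne in auto)
  with eq show "nc_poly_eval R a f \<in> J" by simp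
qed

section \<open>Prime rings\<close>

text \<open>
  The product of two ideals consists of the sums of products of their elements, hence its vanishing
  may be tested on products.
\<close>

lemma prime_ring_iff:
  fixes R (structure)
  shows
  "prime_ring R \<longleftrightarrow> ring R \<and> carrier R \<noteq> {\<zero>\<^bsub>R\<^esub>} \<and>
    (\<forall>I J. ideal I R \<longrightarrow> ideal J R \<longrightarrow> (\<forall>x\<in>I. \<forall>y\<in>J. x \<otimes>\<^bsub>R\<^esub> y = \<zero>\<^bsub>R\<^esub>) \<longrightarrow>
      I = {\<zero>\<^bsub>R\<^esub>} \<or> J = {\<zero>\<^bsub>R\<^esub>})"
proof -
  have eq: "I \<cdot>\<^bsub>R\<^esub> J = {\<zero>\<^bsub>R\<^esub>} \<longleftrightarrow> (\<forall>x\<in>I. \<forall>y\<in>J. x \<otimes>\<^bsub>R\<^esub> y = \<zero>\<^bsub>R\<^esub>)"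
    if "ring R" "ideal I R" "ideal J R" for I J
  proof -
    interpret ring R by fact
    have zero: "\<zero> \<in> I \<cdot> J"
      using ideal_prod_is_ideal[OF that(2,3)] by (simp add: ideal_def additive_subgroup.zero_closed)
    show ?thesis
    proof (intro iffI ballI)
      fix x y assume "I \<cdot> J = {\<zero>}" "x \<in> I" "y \<in> J"
      then show "x \<otimes> y = \<zero>" using ideal_prod.prod[of x I y J R] by simp
    next
      assume all_zero: "\<forall>x\<in>I. \<forall>y\<in>J. x \<otimes> y = \<zero>"
      have "s = \<zero>" if "s \<in> I \<cdot> J" for s
        using that all_zero by (induction s rule: ideal_prod.induct) auto
      with zero show "I \<cdot> J = {\<zero>}" by blast
    qed
  qed
  show ?thesis
    unfolding prime_ring_def by (intro conj_cong all_cong1 imp_cong refl eq; assumption)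
qed

lemma prime_ring_iso:
  fixes R (structure) and S (structure)
  assumes "ring S" and h: "h \<in> ring_iso R S" and R: "prime_ring R"
  shows "prime_ring S"
proof -
  have "ring R" using R by (simp add: prime_ring_def)
  interpret ring_hom_ring R S h
    using \<open>ring R\<close> \<open>ring S\<close> h by (intro ring_hom_ringI2) (auto simp: ring_iso_def)
  have inj: "inj_on h (carrier R)" and surj: "h ` carrier R = carrier S"
    using h by (auto simp: ring_iso_def bij_betw_def)
  have zero_iff: "h x = \<zero>\<^bsub>S\<^esub> \<longleftrightarrow> x = \<zero>" if "x \<in> carrier R" for x
    using inj_onD[OF inj, of x \<zero>] that by auto
  have pre: "I = {\<zero>\<^bsub>S\<^esub>}" if I: "ideal I S" and "{r \<in> carrier R. h r \<in> I} = {\<zero>}" for I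
  proof -
    have "I \<subseteq> {\<zero>\<^bsub>S\<^esub>}"
    proof
      fix y assume y: "y \<in> I"
      then obtain x where "x \<in> carrier R" "y = h x"
        using ideal.Icarr[OF I] surj by blast
      with y that(2) have "x = \<zero>" by blast
      with \<open>y = h x\<close> show "y \<in> {\<zero>\<^bsub>S\<^esub>}" by simp
    qed
    then show ?thesis
      using additive_subgroup.zero_closed[OF ideal.axioms(1)[OF I]] by blast
  qed
  have "I = {\<zero>\<^bsub>S\<^esub>} \<or> J = {\<zero>\<^bsub>S\<^esub>}"
    if I: "ideal I S" and J: "ideal J S" and IJ: "\<forall>x\<in>I. \<forall>y\<in>J. x \<otimes>\<^bsub>S\<^esub> y = \<zero>\<^bsub>S\<^esub>" for I J
  proof -
    have "\<forall>x\<in>{r \<in> carrier R. h r \<in> I}. \<forall>y\<in>{r \<in> carrier R. h r \<in> J}. x \<otimes> y = \<zero>"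
      using IJ by (auto simp flip: zero_iff)
    then have "{r \<in> carrier R. h r \<in> I} = {\<zero>} \<or> {r \<in> carrier R. h r \<in> J} = {\<zero>}"
      using R ideal_vimage[OF I] ideal_vimage[OF J] unfolding prime_ring_iff by blast
    with pre[OF I] pre[OF J] show ?thesis by blast
  qed
  moreover have "carrier S \<noteq> {\<zero>\<^bsub>S\<^esub>}"
  proof
    assume "carrier S = {\<zero>\<^bsub>S\<^esub>}"
    then have "carrier R = {\<zero>}" using zero_iff hom_closed by auto
    with R show False by (simp add: prime_ring_def)
  qed
  ultimately show ?thesis
    using \<open>ring S\<close> unfolding prime_ring_iff by blast
qed

text \<open>
  The right annihilator \<open>B\<close> of \<open>N\<close> is an ideal with \<open>N B = 0\<close>, so if
  \<open>N \<noteq> 0\<close>, then primeness gives \<open>B = 0\<close>. If all products of \<open>m + 1\<close> elements of \<open>N\<close> vanish, then products of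
  \<open>m\<close> elements lie in \<open>B\<close> and vanish as well; descending from \<open>n\<close> to the empty product yields \<open>1 = 0\<close>.
\<close>

lemma nilpotent_ideal_of_prime_ring:
  fixes R (structure)
  assumes R: "prime_ring R" and N: "ideal N R"
    and nil: "\<And>xs. \<lbrakk>set xs \<subseteq> N; length xs = n\<rbrakk> \<Longrightarrow> foldr (\<otimes>) xs \<one> = \<zero>"
  shows "N = {\<zero>}"
proof (rule ccontr)
  assume N0: "N \<noteq> {\<zero>}"
  interpret ring R using R by (simp add: prime_ring_def)
  interpret N: ideal N R by fact
  define B where "B = {y \<in> carrier R. \<forall>x\<in>N. x \<otimes> y = \<zero>}"
  have "ideal B R"
  proof (rule idealI[OF ring_axioms])
    show "subgroup B (add_monoid R)"
      by (rule add.subgroupI) (auto simp: B_def r_distr r_minus N.Icarr)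
    show "x \<otimes> y \<in> B" if "y \<in> B" "x \<in> carrier R" for x y
      using that N.I_r_closed by (auto simp: B_def N.Icarr simp flip: m_assoc)
    show "y \<otimes> x \<in> B" if "y \<in> B" "x \<in> carrier R" for x y
      using that by (auto simp: B_def N.Icarr simp flip: m_assoc)
  qed
  then have B: "B = {\<zero>}"
    using R N N0 unfolding prime_ring_iff B_def by blast
  have "foldr (\<otimes>) xs \<one> = \<zero>" if "k \<le> n" "set xs \<subseteq> N" "length xs = n - k" for k xs
    using that
  proof (induction k arbitrary: xs)
    case 0
    then show ?case using nil by simp
  next
    case (Suc k)
    have "foldr (\<otimes>) xs \<one> \<in> B"
      unfolding B_def
    proof (intro CollectI conjI ballI)
      show "foldr (\<otimes>) xs \<one> \<in> carrier R"
        using Suc.prems(2) N.Icarr by (intro foldr_mult_closed) auto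
      fix x assume "x \<in> N"
      then show "x \<otimes> foldr (\<otimes>) xs \<one> = \<zero>"
        using Suc.IH[of "x # xs"] Suc.prems by simp
    qed
    then show ?case by (simp add: B)
  qed
  from this[of n "[]"] have "\<one> = \<zero>" by simp
  then show False
    using R one_zeroD by (simp add: prime_ring_def)
qed

section \<open>Extensions with nilpotent kernel\<close>

lemma FactRing_zero: "\<zero>\<^bsub>R Quot I\<^esub> = I"
  by (simp add: FactRing_def)

lemma carrier_FactRing: "carrier (R Quot I) = (+>\<^bsub>R\<^esub>) I ` carrier R"
  by (auto simp: FactRing_simps)

lemma (in ring_hom_ring) mem_kernel_iff: "x \<in> a_kernel R S h \<longleftrightarrow> x \<in> carrier R \<and> h x = \<zero>\<^bsub>S\<^esub>"
  unfolding a_kernel_def' by blast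

lemma (in ring_hom_ring) hom_foldr_mult:
  "set xs \<subseteq> carrier R \<Longrightarrow> h (foldr (\<otimes>) xs \<one>) = foldr (\<otimes>\<^bsub>S\<^esub>) (map h xs) \<one>\<^bsub>S\<^esub>"
  by (induction xs) (auto simp: R.foldr_mult_closed)

text \<open>
  Every assignment of values in \<open>S\<close> lifts along \<open>h\<close>, so an identity of \<open>R\<close> is an identity of \<open>S\<close>.
\<close>

lemma (in ring_hom_ring) satisfies_PI_surj:
  assumes surj: "h ` carrier R = carrier S" and "satisfies_PI R"
  shows "satisfies_PI S"
proof -
  obtain f where f: "[] \<notin> keys f" "nc_monic f"
    and id: "\<And>a. (\<And>x. a x \<in> carrier R) \<Longrightarrow> nc_poly_eval R a f = \<zero>"
    using \<open>satisfies_PI R\<close> unfolding satisfies_PI_def by metis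
  have "nc_poly_eval S b f = \<zero>\<^bsub>S\<^esub>" if b: "\<And>x. b x \<in> carrier S" for b
  proof -
    define a where "a = inv_into (carrier R) h \<circ> b"
    have a: "a x \<in> carrier R" for x
      using b[of x] by (simp add: a_def inv_into_into flip: surj)
    have "h \<circ> a = b"
      using b by (auto simp: a_def f_inv_into_f simp flip: surj)
    then show ?thesis
      using hom_nc_poly_eval[of a f] a f(1) id[OF a] by (auto simp: image_subset_iff)
  qed
  with f show ?thesis unfolding satisfies_PI_def by blast
qed

lemma (in ring_hom_ring) ideal_image:
  assumes surj: "h ` carrier R = carrier S" and I: "ideal I R"
  shows "ideal (h ` I) S"
proof (rule idealI[OF S.ring_axioms])
  interpret I: ideal I R by fact
  show "subgroup (h ` I) (add_monoid S)"
    using I.a_subgroup by (rule img_is_add_subgroup)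
  fix y x assume "y \<in> h ` I" "x \<in> carrier S"
  then obtain y' x' where y': "y' \<in> I" "y = h y'" and x': "x' \<in> carrier R" "x = h x'"
    using surj by blast
  then have "x \<otimes>\<^bsub>S\<^esub> y = h (x' \<otimes> y')" "y \<otimes>\<^bsub>S\<^esub> x = h (y' \<otimes> x')"
    by (simp_all add: I.Icarr)
  with x' y' show "x \<otimes>\<^bsub>S\<^esub> y \<in> h ` I" "y \<otimes>\<^bsub>S\<^esub> x \<in> h ` I"
    by (metis imageI I.I_l_closed, metis imageI I.I_r_closed)
qed

text \<open>
  This is the first isomorphism theorem for the composite of \<open>h\<close> and the projection modulo \<open>Q\<close>.
\<close>

lemma (in ring_hom_ring) Quot_vimage_iso:
  assumes surj: "h ` carrier R = carrier S" and Q: "ideal Q S"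
  shows "R Quot {r \<in> carrier R. h r \<in> Q} \<simeq> S Quot Q"
proof -
  interpret Q: ideal Q S by fact
  interpret proj: ring_hom_ring S "S Quot Q" "(+>\<^bsub>S\<^esub>) Q"
    by (rule Q.rcos_ring_hom_ring)
  interpret comp: ring_hom_ring R "S Quot Q" "(+>\<^bsub>S\<^esub>) Q \<circ> h"
    using ring_hom_trans[OF homh Q.rcos_ring_hom]
    by (intro ring_hom_ringI2 R.ring_axioms Q.quotient_is_ring)
  have "Q +>\<^bsub>S\<^esub> h r = \<zero>\<^bsub>S Quot Q\<^esub> \<longleftrightarrow> h r \<in> Q" if "r \<in> carrier R" for r
    using that S.a_rcos_zero[OF Q, of "h r"] Q.rcos_const_imp_mem[of "h r"]
    unfolding FactRing_zero by (metis hom_closed)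
  then have "a_kernel R (S Quot Q) ((+>\<^bsub>S\<^esub>) Q \<circ> h) = {r \<in> carrier R. h r \<in> Q}"
    unfolding set_eq_iff comp.mem_kernel_iff by auto
  moreover have "((+>\<^bsub>S\<^esub>) Q \<circ> h) ` carrier R = carrier (S Quot Q)"
    by (simp only: image_comp[symmetric] surj carrier_FactRing)
  ultimately show ?thesis
    using comp.FactRing_iso by simp
qed

text \<open>
  A surjective homomorphism whose kernel \<open>K\<close> satisfies \<open>K\<^sup>n = 0\<close>, expressed by the vanishing of all
  products of \<open>n\<close> elements of \<open>K\<close>. All four claims hold in this generality.
\<close>

locale nilpotent_extension = ring_hom_ring +
  fixes n :: nat
  assumes surj: "h ` carrier R = carrier S"
    and index_pos: "n > 0"
    and kernel_nilpotent:
      "\<lbrakk>set xs \<subseteq> a_kernel R S h; length xs = n\<rbrakk> \<Longrightarrow> foldr (\<otimes>) xs \<one> = \<zero>"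
begin

lemma kernel_pow: "x \<in> a_kernel R S h \<Longrightarrow> x [^] n = \<zero>"
  using kernel_nilpotent[of "replicate n x"] R.foldr_mult_replicate[of x n]
  by (simp add: mem_kernel_iff set_replicate_conv_if del: foldr_replicate)

text \<open>
  If \<open>f\<close> is an identity of \<open>S\<close>, then the values of \<open>f\<close> on \<open>R\<close> lie in the kernel, so \<open>f\<^sup>n\<close> is an
  identity of \<open>R\<close>; it inherits a leading coefficient 1 from \<open>f\<close>.
\<close>

lemma satisfies_PI_iff: "satisfies_PI S \<longleftrightarrow> satisfies_PI R"
proof
  assume "satisfies_PI S"
  then obtain f where f: "[] \<notin> keys f" "nc_monic f"
    and id: "\<And>a. (\<And>x. a x \<in> carrier S) \<Longrightarrow> nc_poly_eval S a f = \<zero>\<^bsub>S\<^esub>"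
    unfolding satisfies_PI_def by metis
  \<comment> \<open>The index \<open>n - 1\<close> stands for the exponent \<open>n\<close>.\<close>
  have "nc_poly_eval R a (nc_power f (n - 1)) = \<zero>" if "\<And>x. a x \<in> carrier R" for a
  proof -
    have a: "range a \<subseteq> carrier R" using that by auto
    have "h (nc_poly_eval R a f) = \<zero>\<^bsub>S\<^esub>"
      using hom_nc_poly_eval[OF a f(1)] id[of "h \<circ> a"] that by simp
    then have "nc_poly_eval R a f \<in> a_kernel R S h"
      using R.nc_poly_eval_closed[OF a f(1)] by (simp add: mem_kernel_iff)
    then show ?thesis
      using R.nc_poly_eval_nc_power[OF a f(1), of "n - 1"] kernel_pow index_pos by simp
  qed
  then show "satisfies_PI R"
    unfolding satisfies_PI_def
    using Nil_notin_keys_nc_power[OF f(1)] nc_monic_nc_power[OF f(2)] by blast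
qed (rule satisfies_PI_surj[OF surj])

lemma commutator_pow_zero:
  assumes "cring S" "x \<in> carrier R" "y \<in> carrier R"
  shows "(x \<otimes> y \<ominus> y \<otimes> x) [^] n = \<zero>"
proof (rule kernel_pow)
  have "h x \<otimes>\<^bsub>S\<^esub> h y = h y \<otimes>\<^bsub>S\<^esub> h x"
    using assms by (intro comm_monoid.m_comm) (auto simp: cring_def)
  then show "x \<otimes> y \<ominus> y \<otimes> x \<in> a_kernel R S h"
    using assms by (simp add: mem_kernel_iff a_minus_def S.r_neg)
qed

text \<open>
  The image of the kernel is a nilpotent ideal of the prime ring \<open>R / P\<close>, hence zero.
\<close>

lemma kernel_subset_prime:
  assumes P: "ideal P R" and prime: "prime_ring (R Quot P)"
  shows "a_kernel R S h \<subseteq> P"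
proof
  interpret P: ideal P R by fact
  interpret proj: ring_hom_ring R "R Quot P" "(+>) P"
    by (rule P.rcos_ring_hom_ring)
  let ?K = "a_kernel R S h"
  have K: "ideal ?K R" by (rule kernel_is_ideal)
  have "(+>) P ` ?K = {\<zero>\<^bsub>R Quot P\<^esub>}"
  proof (rule nilpotent_ideal_of_prime_ring[OF prime R.ring_ideal_imp_quot_ideal[OF P K]])
    fix ys assume ys: "set ys \<subseteq> (+>) P ` ?K" "length ys = n"
    define xs where "xs = map (inv_into ?K ((+>) P)) ys"
    have xs: "set xs \<subseteq> ?K" "length xs = n"
      using ys by (auto simp: xs_def intro: inv_into_into)
    have map: "map ((+>) P) xs = ys"
      using ys(1) by (auto simp: xs_def subset_iff f_inv_into_f intro!: map_idI)
    have "set xs \<subseteq> carrier R" using xs(1) ideal.Icarr[OF K] by auto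
    from proj.hom_foldr_mult[OF this] map
    show "foldr (\<otimes>\<^bsub>R Quot P\<^esub>) ys \<one>\<^bsub>R Quot P\<^esub> = \<zero>\<^bsub>R Quot P\<^esub>"
      using kernel_nilpotent[OF xs] by simp
  qed
  moreover fix x assume x: "x \<in> ?K"
  ultimately have "P +> x = \<zero>\<^bsub>R Quot P\<^esub>" by blast
  then have "P +> x = P" unfolding FactRing_zero .
  then show "x \<in> P" by (rule P.rcos_const_imp_mem[OF ideal.Icarr[OF K x]])
qed

lemma vimage_image_ideal:
  assumes P: "ideal P R" and kernel: "a_kernel R S h \<subseteq> P"
  shows "{r \<in> carrier R. h r \<in> h ` P} = P"
proof -
  interpret P: ideal P R by fact
  have "r \<in> P" if r: "r \<in> carrier R" and p: "p \<in> P" "h r = h p" for r p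
  proof -
    have "r \<ominus> p \<in> a_kernel R S h"
      using r p P.Icarr by (simp add: mem_kernel_iff a_minus_def S.r_neg)
    then have "(r \<ominus> p) \<oplus> p \<in> P" using kernel p by auto
    then show ?thesis
      using r p P.Icarr by (simp add: a_minus_def R.a_assoc R.l_neg)
  qed
  then show ?thesis using P.Icarr by auto
qed

text \<open>
  All prime ideals of \<open>R\<close> contain the kernel, so \<open>P \<mapsto> h(P)\<close> and \<open>Q \<mapsto> h\<^bsup>-1\<^esup>(Q)\<close> match the prime factor
  rings of \<open>R\<close> and \<open>S\<close> up to isomorphism.
\<close>

lemma almost_PI_iff: "almost_PI S \<longleftrightarrow> almost_PI R"
proof -
  have transfer: "satisfies_PI B"
    if "A \<simeq> B" "ring A" "ring B" "satisfies_PI A"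
    for A :: "('x, 'y) ring_scheme" and B :: "('z, 'w) ring_scheme"
  proof -
    obtain g where g: "g \<in> ring_iso A B" using \<open>A \<simeq> B\<close> by (auto simp: is_ring_iso_def)
    interpret g: ring_hom_ring A B g
      using that g by (intro ring_hom_ringI2) (auto simp: ring_iso_def)
    show ?thesis
      using g.satisfies_PI_surj that g by (auto simp: ring_iso_def bij_betw_def)
  qed
  show ?thesis
  proof
    assume PI: "almost_PI S"
    show "almost_PI R"
      unfolding almost_PI_def
    proof (intro allI impI)
      fix P assume P: "ideal P R" and prime: "prime_ring (R Quot P)"
      have Q: "ideal (h ` P) S" using surj P by (rule ideal_image)
      have rings: "ring (R Quot P)" "ring (S Quot h ` P)"
        using P Q by (simp_all add: ideal.quotient_is_ring)
      have iso: "R Quot P \<simeq> S Quot h ` P"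
        using Quot_vimage_iso[OF surj Q] vimage_image_ideal[OF P kernel_subset_prime[OF P prime]]
        by simp
      then have "prime_ring (S Quot h ` P)"
        using prime_ring_iso[OF rings(2) _ prime] by (auto simp: is_ring_iso_def)
      then have "satisfies_PI (S Quot h ` P)"
        using PI Q unfolding almost_PI_def by blast
      then show "satisfies_PI (R Quot P)"
        using transfer ring_iso_sym[OF rings(1) iso] rings by blast
    qed
  next
    assume PI: "almost_PI R"
    show "almost_PI S"
      unfolding almost_PI_def
    proof (intro allI impI)
      fix Q assume Q: "ideal Q S" and prime: "prime_ring (S Quot Q)"
      let ?P = "{r \<in> carrier R. h r \<in> Q}"
      have P: "ideal ?P R" using Q by (rule ideal_vimage)
      have rings: "ring (R Quot ?P)" "ring (S Quot Q)"
        using P Q by (simp_all add: ideal.quotient_is_ring)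
      have iso: "R Quot ?P \<simeq> S Quot Q" by (rule Quot_vimage_iso[OF surj Q])
      then have "prime_ring (R Quot ?P)"
        using prime_ring_iso[OF rings(1) _ prime] ring_iso_sym[OF rings(1)]
        by (auto simp: is_ring_iso_def)
      then have "satisfies_PI (R Quot ?P)"
        using PI P unfolding almost_PI_def by blast
      then show "satisfies_PI (S Quot Q)"
        using transfer iso rings by blast
    qed
  qed
qed

text \<open>
  The identity is \<open>x\<^sub>0 x\<^sub>1 \<cdots> x\<^bsub>n-1\<^esub>\<close>, which is a nonempty word because \<open>n > 0\<close>.
\<close>

lemma satisfies_PI_subideal_of_kernel:
  assumes J: "ideal J R" and "J \<subseteq> a_kernel R S h"
  shows "satisfies_PI (R\<lparr>carrier := J\<rparr>)"
proof -
  interpret J: ideal J R by fact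
  let ?f = "Poly_Mapping.single [0..<n] (1::int)"
  have w: "[0..<n] \<noteq> []" using index_pos by simp
  then have f: "[] \<notin> keys ?f" by (metis keys_single empty_iff singletonD)
  have "nc_poly_eval (R\<lparr>carrier := J\<rparr>) a ?f = \<zero>" if "\<And>x. a x \<in> J" for a
  proof -
    have a: "range a \<subseteq> J" "range a \<subseteq> carrier R" using that J.Icarr by auto
    have "nc_poly_eval (R\<lparr>carrier := J\<rparr>) a ?f = nc_poly_eval R a ?f"
      using a(1) f J.I_l_closed J.Icarr
      by (intro R.nc_poly_eval_additive_subgroup(1) J.is_additive_subgroup) auto
    also have "\<dots> = foldr (\<otimes>) (map a [0..<n]) \<one>"
      using R.nc_poly_eval_single[OF a(2) w, of 1] R.word_eval_closed[OF a(2) w]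
        R.word_eval_eq_foldr[OF a(2) w] by (simp add: R.add.int_pow_1)
    also have "\<dots> = \<zero>"
      using a(1) assms(2) by (intro kernel_nilpotent) auto
    finally show ?thesis .
  qed
  moreover have "nc_monic ?f" by (simp add: nc_monic_def)
  ultimately show ?thesis
    unfolding satisfies_PI_def using f by (intro exI[of _ ?f]) auto
qed

text \<open>
  Let \<open>K\<close> be the kernel and \<open>I \<noteq> 0\<close> an ideal of \<open>R\<close>. If \<open>I \<inter> K \<noteq> 0\<close>, this is a nilpotent ideal, hence a
  PI-ideal. Otherwise \<open>h\<close> is injective on \<open>I\<close>; the nonzero ideal \<open>h(I)\<close> of \<open>S\<close> contains a nonzero PI-ideal \<open>Q\<close>,
  and \<open>h\<close> maps the ideal \<open>I \<inter> h\<^bsup>-1\<^esup>(Q)\<close> isomorphically onto \<open>Q\<close>.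
\<close>

lemma intrinsically_PI_lift:
  assumes "intrinsically_PI S"
  shows "intrinsically_PI R"
  unfolding intrinsically_PI_def
proof (intro allI impI)
  fix I assume I: "ideal I R" and I0: "I \<noteq> {\<zero>}"
  interpret I: ideal I R by fact
  let ?K = "a_kernel R S h"
  show "\<exists>J. ideal J R \<and> J \<subseteq> I \<and> J \<noteq> {\<zero>} \<and> satisfies_PI (R\<lparr>carrier := J\<rparr>)"
  proof (cases "I \<inter> ?K = {\<zero>}")
    case False
    moreover have "ideal (I \<inter> ?K) R"
      using R.i_intersect[OF I kernel_is_ideal] .
    ultimately show ?thesis
      using satisfies_PI_subideal_of_kernel by (intro exI[of _ "I \<inter> ?K"]) auto
  next
    case True
    have inj: "x = \<zero>" if "x \<in> I" "h x = \<zero>\<^bsub>S\<^esub>" for x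
    proof -
      have "x \<in> I \<inter> ?K" using that I.Icarr by (simp add: mem_kernel_iff)
      with True show ?thesis by blast
    qed
    have hI: "ideal (h ` I) S" using surj I by (rule ideal_image)
    obtain x where "x \<in> I" "x \<noteq> \<zero>"
      using I0 I.zero_closed by blast
    then have "h ` I \<noteq> {\<zero>\<^bsub>S\<^esub>}" using inj by blast
    then obtain Q where Q: "ideal Q S" "Q \<subseteq> h ` I" "Q \<noteq> {\<zero>\<^bsub>S\<^esub>}"
      and PI: "satisfies_PI (S\<lparr>carrier := Q\<rparr>)"
      using assms hI unfolding intrinsically_PI_def by blast
    interpret Q: ideal Q S by fact
    let ?J = "I \<inter> {r \<in> carrier R. h r \<in> Q}"
    have J: "ideal ?J R"
      using R.i_intersect[OF I ideal_vimage[OF Q(1)]] .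
    obtain q where q: "q \<in> Q" "q \<noteq> \<zero>\<^bsub>S\<^esub>"
      using Q(3) Q.zero_closed by blast
    then obtain r where r: "r \<in> I" "q = h r" using Q(2) by blast
    have "r \<in> ?J" using q(1) r I.Icarr[OF r(1)] by blast
    moreover have "r \<noteq> \<zero>" using q(2) r(2) hom_zero by metis
    ultimately have J0: "?J \<noteq> {\<zero>}" by blast
    obtain f where f: "[] \<notin> keys f" "nc_monic f"
      and id: "\<And>a. (\<And>x. a x \<in> Q) \<Longrightarrow> nc_poly_eval (S\<lparr>carrier := Q\<rparr>) a f = \<zero>\<^bsub>S\<^esub>"
      using PI unfolding satisfies_PI_def by auto
    have "nc_poly_eval (R\<lparr>carrier := ?J\<rparr>) a f = \<zero>" if a: "\<And>x. a x \<in> ?J" for a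
    proof -
      have "a x \<in> I" "a x \<in> carrier R" "h (a x) \<in> Q" for x using a[of x] by blast+
      then have ran: "range a \<subseteq> ?J" "range a \<subseteq> I" "range a \<subseteq> carrier R" "range (h \<circ> a) \<subseteq> Q"
        using a by (simp_all only: image_subset_iff comp_apply ball_UNIV simp_thms)
      have eq: "nc_poly_eval (R\<lparr>carrier := ?J\<rparr>) a f = nc_poly_eval R a f"
        using R.nc_poly_eval_additive_subgroup(1)[OF ideal.axioms(1)[OF J] _ ran(1) f(1)]
          ideal.I_l_closed[OF J] ideal.Icarr[OF J] by blast
      have "nc_poly_eval R a f \<in> I"
        using R.nc_poly_eval_additive_subgroup(2)[OF I.is_additive_subgroup _ ran(2) f(1)]
          I.I_l_closed I.Icarr by blast
      moreover have "h (nc_poly_eval R a f) = \<zero>\<^bsub>S\<^esub>"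
      proof -
        have "h (nc_poly_eval R a f) = nc_poly_eval S (h \<circ> a) f"
          by (rule hom_nc_poly_eval[OF ran(3) f(1)])
        also have "\<dots> = nc_poly_eval (S\<lparr>carrier := Q\<rparr>) (h \<circ> a) f"
          using S.nc_poly_eval_additive_subgroup(1)[OF Q.is_additive_subgroup _ ran(4) f(1)]
            Q.I_l_closed Q.Icarr by metis
        also have "\<dots> = \<zero>\<^bsub>S\<^esub>" by (rule id) (use ran(4) in auto)
        finally show ?thesis .
      qed
      ultimately show ?thesis unfolding eq by (rule inj)
    qed
    then have "satisfies_PI (R\<lparr>carrier := ?J\<rparr>)"
      unfolding satisfies_PI_def using f by (intro exI[of _ f]) simp
    with J J0 show ?thesis by (intro exI[of _ ?J] conjI Int_lower1)
  qed
qed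

end

section \<open>Generalized matrix rings\<close>

lemma (in abelian_monoid) finsum_swap:
  assumes "finite A" "finite B" "\<And>i j. \<lbrakk>i \<in> A; j \<in> B\<rbrakk> \<Longrightarrow> f i j \<in> carrier G"
  shows "(\<Oplus>i\<in>A. \<Oplus>j\<in>B. f i j) = (\<Oplus>j\<in>B. \<Oplus>i\<in>A. f i j)"
  using assms(1,3)
proof (induction A rule: finite_induct)
  case (insert x A)
  then have "(\<Oplus>j\<in>B. \<Oplus>i\<in>insert x A. f i j) = (\<Oplus>j\<in>B. f x j \<oplus> (\<Oplus>i\<in>A. f i j))"
    by (intro finsum_cong') (auto simp: Pi_def)
  with insert show ?case
    by (simp add: finsum_addf Pi_def)
qed simp

context generalized_matrix_ring
begin

abbreviation "MR \<equiv> matrix_ring n M \<theta>"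

lemma entry_abelian_group: "\<lbrakk>i \<in> {1..n}; j \<in> {1..n}\<rbrakk> \<Longrightarrow> abelian_group (M i j)"
  using diag_ring[of i] off_diag_bimodule[of i j] ring.is_abelian_group
  by (cases "i = j") (auto simp: bimodule_def)

lemma entry_zero_closed: "\<lbrakk>i \<in> {1..n}; j \<in> {1..n}\<rbrakk> \<Longrightarrow> \<zero>\<^bsub>M i j\<^esub> \<in> carrier (M i j)"
  using entry_abelian_group abelian_group.axioms(1) abelian_monoid.zero_closed by blast

lemma theta_zero_left:
  assumes i: "i \<in> {1..n}" and j: "j \<in> {1..n}" and k: "k \<in> {1..n}" and y: "y \<in> carrier (M j k)"
  shows "\<theta> i j k \<zero>\<^bsub>M i j\<^esub> y = \<zero>\<^bsub>M i k\<^esub>"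
proof -
  interpret ij: abelian_group "M i j" using i j by (rule entry_abelian_group)
  interpret ik: abelian_group "M i k" using i k by (rule entry_abelian_group)
  have "\<theta> i j k \<zero>\<^bsub>M i j\<^esub> y \<oplus>\<^bsub>M i k\<^esub> \<theta> i j k \<zero>\<^bsub>M i j\<^esub> y = \<theta> i j k \<zero>\<^bsub>M i j\<^esub> y"
    using theta_add_left[OF i j k ij.zero_closed ij.zero_closed y] by simp
  then show ?thesis
    using theta_closed[OF i j k ij.zero_closed y] ik.add.l_cancel_one' by metis
qed

lemma theta_zero_right:
  assumes i: "i \<in> {1..n}" and j: "j \<in> {1..n}" and k: "k \<in> {1..n}" and x: "x \<in> carrier (M i j)"
  shows "\<theta> i j k x \<zero>\<^bsub>M j k\<^esub> = \<zero>\<^bsub>M i k\<^esub>"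
proof -
  interpret jk: abelian_group "M j k" using j k by (rule entry_abelian_group)
  interpret ik: abelian_group "M i k" using i k by (rule entry_abelian_group)
  have "\<theta> i j k x \<zero>\<^bsub>M j k\<^esub> \<oplus>\<^bsub>M i k\<^esub> \<theta> i j k x \<zero>\<^bsub>M j k\<^esub> = \<theta> i j k x \<zero>\<^bsub>M j k\<^esub>"
    using theta_add_right[OF i j k x jk.zero_closed jk.zero_closed] by simp
  then show ?thesis
    using theta_closed[OF i j k x jk.zero_closed] ik.add.l_cancel_one' by metis
qed

lemma theta_finsum_left:
  assumes i: "i \<in> {1..n}" and j: "j \<in> {1..n}" and k: "k \<in> {1..n}" and y: "y \<in> carrier (M j k)"
    and "finite A" and f: "f \<in> A \<rightarrow> carrier (M i j)"
  shows "\<theta> i j k (finsum (M i j) f A) y = (\<Oplus>\<^bsub>M i k\<^esub>t\<in>A. \<theta> i j k (f t) y)"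
proof -
  interpret ij: abelian_group "M i j" using i j by (rule entry_abelian_group)
  interpret ik: abelian_group "M i k" using i k by (rule entry_abelian_group)
  show ?thesis
    using \<open>finite A\<close> f
  proof (induction A rule: finite_induct)
    case empty
    then show ?case using theta_zero_left[OF i j k y] by simp
  next
    case (insert t A)
    then have f: "f t \<in> carrier (M i j)" "f \<in> A \<rightarrow> carrier (M i j)" by auto
    have "\<theta> i j k (finsum (M i j) f (insert t A)) y
        = \<theta> i j k (f t) y \<oplus>\<^bsub>M i k\<^esub> \<theta> i j k (finsum (M i j) f A) y"
      using insert(1,2) f ij.finsum_closed[OF f(2)] by (simp add: theta_add_left[OF i j k _ _ y])
    also have "\<dots> = \<theta> i j k (f t) y \<oplus>\<^bsub>M i k\<^esub> (\<Oplus>\<^bsub>M i k\<^esub>t\<in>A. \<theta> i j k (f t) y)"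
      using insert.IH[OF f(2)] by simp
    also have "\<dots> = (\<Oplus>\<^bsub>M i k\<^esub>t\<in>insert t A. \<theta> i j k (f t) y)"
      by (rule ik.finsum_insert[symmetric]) (use insert(1,2) f theta_closed[OF i j k _ y] in auto)
    finally show ?case .
  qed
qed

lemma theta_finsum_right:
  assumes i: "i \<in> {1..n}" and j: "j \<in> {1..n}" and k: "k \<in> {1..n}" and x: "x \<in> carrier (M i j)"
    and "finite A" and f: "f \<in> A \<rightarrow> carrier (M j k)"
  shows "\<theta> i j k x (finsum (M j k) f A) = (\<Oplus>\<^bsub>M i k\<^esub>t\<in>A. \<theta> i j k x (f t))"
proof -
  interpret jk: abelian_group "M j k" using j k by (rule entry_abelian_group)
  interpret ik: abelian_group "M i k" using i k by (rule entry_abelian_group)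
  show ?thesis
    using \<open>finite A\<close> f
  proof (induction A rule: finite_induct)
    case empty
    then show ?case using theta_zero_right[OF i j k x] by simp
  next
    case (insert t A)
    then have f: "f t \<in> carrier (M j k)" "f \<in> A \<rightarrow> carrier (M j k)" by auto
    have "\<theta> i j k x (finsum (M j k) f (insert t A))
        = \<theta> i j k x (f t) \<oplus>\<^bsub>M i k\<^esub> \<theta> i j k x (finsum (M j k) f A)"
      using insert(1,2) f jk.finsum_closed[OF f(2)] by (simp add: theta_add_right[OF i j k x])
    also have "\<dots> = \<theta> i j k x (f t) \<oplus>\<^bsub>M i k\<^esub> (\<Oplus>\<^bsub>M i k\<^esub>t\<in>A. \<theta> i j k x (f t))"
      using insert.IH[OF f(2)] by simp
    also have "\<dots> = (\<Oplus>\<^bsub>M i k\<^esub>t\<in>insert t A. \<theta> i j k x (f t))"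
      by (rule ik.finsum_insert[symmetric]) (use insert(1,2) f theta_closed[OF i j k x] in auto)
    finally show ?case .
  qed
qed

lemma theta_one_left:
  "\<lbrakk>i \<in> {1..n}; j \<in> {1..n}; x \<in> carrier (M i j)\<rbrakk> \<Longrightarrow> \<theta> i i j \<one>\<^bsub>M i i\<^esub> x = x"
  using diag_mult[of i "\<one>\<^bsub>M i i\<^esub>" x] diag_ring[of i] bimodule.lmul_one[OF off_diag_bimodule[of i j]]
  by (cases "i = j") (auto simp: ring_def monoid.l_one monoid.one_closed)

lemma theta_one_right:
  "\<lbrakk>i \<in> {1..n}; j \<in> {1..n}; x \<in> carrier (M i j)\<rbrakk> \<Longrightarrow> \<theta> i j j x \<one>\<^bsub>M j j\<^esub> = x"
  using diag_mult[of i x "\<one>\<^bsub>M i i\<^esub>"] diag_ring[of i] bimodule.rmul_one[OF off_diag_bimodule[of i j]]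
  by (cases "i = j") (auto simp: ring_def monoid.r_one monoid.one_closed)

lemma mem_carrier_matrix_ring:
  "A \<in> carrier MR \<longleftrightarrow> A \<in> extensional ({1..n} \<times> {1..n}) \<and>
    (\<forall>i\<in>{1..n}. \<forall>j\<in>{1..n}. A (i, j) \<in> carrier (M i j))"
  by (auto simp: matrix_ring_def PiE_def)

lemma entry_closed:
  "\<lbrakk>A \<in> carrier MR; i \<in> {1..n}; j \<in> {1..n}\<rbrakk> \<Longrightarrow> A (i, j) \<in> carrier (M i j)"
  unfolding mem_carrier_matrix_ring by blast

lemma restrict_mem_carrier:
  assumes "\<And>i j. \<lbrakk>i \<in> {1..n}; j \<in> {1..n}\<rbrakk> \<Longrightarrow> f i j \<in> carrier (M i j)"
  shows "(\<lambda>(i, j)\<in>{1..n} \<times> {1..n}. f i j) \<in> carrier MR"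
  using assms unfolding mem_carrier_matrix_ring by simp

lemma matrix_eqI:
  assumes "A \<in> carrier MR" "B \<in> carrier MR"
    and "\<And>i j. \<lbrakk>i \<in> {1..n}; j \<in> {1..n}\<rbrakk> \<Longrightarrow> A (i, j) = B (i, j)"
  shows "A = B"
  using assms unfolding mem_carrier_matrix_ring by (intro extensionalityI) auto

lemma mult_entry:
  "\<lbrakk>i \<in> {1..n}; k \<in> {1..n}\<rbrakk>
    \<Longrightarrow> (A \<otimes>\<^bsub>MR\<^esub> B) (i, k) = (\<Oplus>\<^bsub>M i k\<^esub>j\<in>{1..n}. \<theta> i j k (A (i, j)) (B (j, k)))"
  by (simp add: matrix_ring_def)

lemma add_entry:
  "\<lbrakk>i \<in> {1..n}; j \<in> {1..n}\<rbrakk> \<Longrightarrow> (A \<oplus>\<^bsub>MR\<^esub> B) (i, j) = A (i, j) \<oplus>\<^bsub>M i j\<^esub> B (i, j)"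
  by (simp add: matrix_ring_def)

lemma zero_entry: "\<lbrakk>i \<in> {1..n}; j \<in> {1..n}\<rbrakk> \<Longrightarrow> \<zero>\<^bsub>MR\<^esub> (i, j) = \<zero>\<^bsub>M i j\<^esub>"
  by (simp add: matrix_ring_def)

lemma one_entry:
  "\<lbrakk>i \<in> {1..n}; j \<in> {1..n}\<rbrakk>
    \<Longrightarrow> \<one>\<^bsub>MR\<^esub> (i, j) = (if i = j then \<one>\<^bsub>M i j\<^esub> else \<zero>\<^bsub>M i j\<^esub>)"
  by (simp add: matrix_ring_def)

lemma summand_closed:
  "\<lbrakk>A \<in> carrier MR; B \<in> carrier MR; i \<in> {1..n}; j \<in> {1..n}; k \<in> {1..n}\<rbrakk>
    \<Longrightarrow> \<theta> i j k (A (i, j)) (B (j, k)) \<in> carrier (M i k)"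
  by (intro theta_closed entry_closed)

lemma mult_mem_carrier:
  assumes "A \<in> carrier MR" "B \<in> carrier MR"
  shows "A \<otimes>\<^bsub>MR\<^esub> B \<in> carrier MR"
proof -
  have "(\<Oplus>\<^bsub>M i k\<^esub>j\<in>{1..n}. \<theta> i j k (A (i, j)) (B (j, k))) \<in> carrier (M i k)"
    if "i \<in> {1..n}" "k \<in> {1..n}" for i k
    using abelian_group.axioms(1)[OF entry_abelian_group[OF that]]
    by (rule abelian_monoid.finsum_closed) (use assms that summand_closed in blast)
  then show ?thesis
    using restrict_mem_carrier by (simp add: matrix_ring_def)
qed

lemma add_mem_carrier:
  assumes "A \<in> carrier MR" "B \<in> carrier MR"
  shows "A \<oplus>\<^bsub>MR\<^esub> B \<in> carrier MR"
proof -
  have "A (i, j) \<oplus>\<^bsub>M i j\<^esub> B (i, j) \<in> carrier (M i j)" if "i \<in> {1..n}" "j \<in> {1..n}" for i j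
    using abelian_group.axioms(1)[OF entry_abelian_group[OF that]]
    by (rule abelian_monoid.a_closed) (use assms that entry_closed in blast)+
  then show ?thesis
    using restrict_mem_carrier by (simp add: matrix_ring_def)
qed

lemma zero_mem_carrier: "\<zero>\<^bsub>MR\<^esub> \<in> carrier MR"
  using restrict_mem_carrier entry_zero_closed by (simp add: matrix_ring_def)

lemma one_mem_carrier: "\<one>\<^bsub>MR\<^esub> \<in> carrier MR"
proof -
  have "(if i = j then \<one>\<^bsub>M i j\<^esub> else \<zero>\<^bsub>M i j\<^esub>) \<in> carrier (M i j)"
    if "i \<in> {1..n}" "j \<in> {1..n}" for i j
    using that entry_zero_closed[of i j] diag_ring[of i]
    by (cases "i = j") (auto simp: ring_def monoid.one_closed)
  then show ?thesis
    using restrict_mem_carrier by (simp add: matrix_ring_def)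
qed

lemma matrix_abelian_group: "abelian_group MR"
proof (rule abelian_groupI)
  fix A B C
  assume A: "A \<in> carrier MR" and B: "B \<in> carrier MR" and C: "C \<in> carrier MR"
  show "A \<oplus>\<^bsub>MR\<^esub> B \<in> carrier MR" using A B by (rule add_mem_carrier)
  show "A \<oplus>\<^bsub>MR\<^esub> B \<oplus>\<^bsub>MR\<^esub> C = A \<oplus>\<^bsub>MR\<^esub> (B \<oplus>\<^bsub>MR\<^esub> C)"
  proof (rule matrix_eqI)
    fix i j assume ij: "i \<in> {1..n}" "j \<in> {1..n}"
    interpret abelian_group "M i j" using ij by (rule entry_abelian_group)
    show "(A \<oplus>\<^bsub>MR\<^esub> B \<oplus>\<^bsub>MR\<^esub> C) (i, j) = (A \<oplus>\<^bsub>MR\<^esub> (B \<oplus>\<^bsub>MR\<^esub> C)) (i, j)"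
      using entry_closed[OF A ij] entry_closed[OF B ij] entry_closed[OF C ij]
      by (simp only: add_entry[OF ij] a_assoc)
  qed (intro add_mem_carrier A B C)+
  show "A \<oplus>\<^bsub>MR\<^esub> B = B \<oplus>\<^bsub>MR\<^esub> A"
  proof (rule matrix_eqI)
    fix i j assume ij: "i \<in> {1..n}" "j \<in> {1..n}"
    interpret abelian_group "M i j" using ij by (rule entry_abelian_group)
    show "(A \<oplus>\<^bsub>MR\<^esub> B) (i, j) = (B \<oplus>\<^bsub>MR\<^esub> A) (i, j)"
      using entry_closed[OF A ij] entry_closed[OF B ij]
      by (simp only: add_entry[OF ij] a_comm)
  qed (intro add_mem_carrier A B)+
  show "\<zero>\<^bsub>MR\<^esub> \<oplus>\<^bsub>MR\<^esub> A = A"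
  proof (rule matrix_eqI)
    fix i j assume ij: "i \<in> {1..n}" "j \<in> {1..n}"
    interpret abelian_group "M i j" using ij by (rule entry_abelian_group)
    show "(\<zero>\<^bsub>MR\<^esub> \<oplus>\<^bsub>MR\<^esub> A) (i, j) = A (i, j)"
      using entry_closed[OF A ij] by (simp only: add_entry[OF ij] zero_entry[OF ij] l_zero)
  qed (intro add_mem_carrier zero_mem_carrier A)+
  let ?N = "\<lambda>(i, j)\<in>{1..n} \<times> {1..n}. \<ominus>\<^bsub>M i j\<^esub> A (i, j)"
  have N: "?N \<in> carrier MR"
    using abelian_group.a_inv_closed[OF entry_abelian_group] entry_closed[OF A]
    by (intro restrict_mem_carrier) blast
  have "?N \<oplus>\<^bsub>MR\<^esub> A = \<zero>\<^bsub>MR\<^esub>"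
  proof (rule matrix_eqI)
    fix i j assume ij: "i \<in> {1..n}" "j \<in> {1..n}"
    interpret abelian_group "M i j" using ij by (rule entry_abelian_group)
    show "(?N \<oplus>\<^bsub>MR\<^esub> A) (i, j) = \<zero>\<^bsub>MR\<^esub> (i, j)"
      unfolding add_entry[OF ij] zero_entry[OF ij]
      using ij entry_closed[OF A ij] by (simp add: l_neg)
  qed (intro add_mem_carrier zero_mem_carrier A N)+
  with N show "\<exists>B\<in>carrier MR. B \<oplus>\<^bsub>MR\<^esub> A = \<zero>\<^bsub>MR\<^esub>" by blast
qed (rule zero_mem_carrier)

lemma matrix_mult_assoc:
  assumes A: "A \<in> carrier MR" and B: "B \<in> carrier MR" and C: "C \<in> carrier MR"
  shows "A \<otimes>\<^bsub>MR\<^esub> B \<otimes>\<^bsub>MR\<^esub> C = A \<otimes>\<^bsub>MR\<^esub> (B \<otimes>\<^bsub>MR\<^esub> C)"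
proof (rule matrix_eqI)
  fix i l assume i: "i \<in> {1..n}" and l: "l \<in> {1..n}"
  interpret il: abelian_group "M i l" using i l by (rule entry_abelian_group)
  let ?t = "\<lambda>j k. \<theta> i j l (A (i, j)) (\<theta> j k l (B (j, k)) (C (k, l)))"
  have t: "?t j k \<in> carrier (M i l)" if "j \<in> {1..n}" "k \<in> {1..n}" for j k
    using that i l A B C by (intro theta_closed entry_closed)
  have "(A \<otimes>\<^bsub>MR\<^esub> B \<otimes>\<^bsub>MR\<^esub> C) (i, l) = (\<Oplus>\<^bsub>M i l\<^esub>k\<in>{1..n}. \<Oplus>\<^bsub>M i l\<^esub>j\<in>{1..n}. ?t j k)"
    unfolding mult_entry[OF i l]
  proof (rule il.finsum_cong'[OF refl])
    fix k assume k: "k \<in> {1..n}"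
    have "\<theta> i k l ((A \<otimes>\<^bsub>MR\<^esub> B) (i, k)) (C (k, l))
        = (\<Oplus>\<^bsub>M i l\<^esub>j\<in>{1..n}. \<theta> i k l (\<theta> i j k (A (i, j)) (B (j, k))) (C (k, l)))"
      unfolding mult_entry[OF i k]
      by (rule theta_finsum_left[OF i k l]) (use A B C i k l summand_closed entry_closed in auto)
    also have "\<dots> = (\<Oplus>\<^bsub>M i l\<^esub>j\<in>{1..n}. ?t j k)"
      by (rule il.finsum_cong'[OF refl]) (use t k i l A B C theta_assoc entry_closed in auto)
    finally show "\<theta> i k l ((A \<otimes>\<^bsub>MR\<^esub> B) (i, k)) (C (k, l)) = (\<Oplus>\<^bsub>M i l\<^esub>j\<in>{1..n}. ?t j k)" .
  qed (use t in auto)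
  also have "\<dots> = (\<Oplus>\<^bsub>M i l\<^esub>j\<in>{1..n}. \<Oplus>\<^bsub>M i l\<^esub>k\<in>{1..n}. ?t j k)"
    by (rule il.finsum_swap) (use t in auto)
  also have "\<dots> = (A \<otimes>\<^bsub>MR\<^esub> (B \<otimes>\<^bsub>MR\<^esub> C)) (i, l)"
    unfolding mult_entry[OF i l]
  proof (rule il.finsum_cong'[OF refl, symmetric])
    fix j assume j: "j \<in> {1..n}"
    show "\<theta> i j l (A (i, j)) ((B \<otimes>\<^bsub>MR\<^esub> C) (j, l)) = (\<Oplus>\<^bsub>M i l\<^esub>k\<in>{1..n}. ?t j k)"
      unfolding mult_entry[OF j l]
      by (rule theta_finsum_right[OF i j l]) (use A B C i j l summand_closed entry_closed in auto)
  qed (use t in auto)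
  finally show "(A \<otimes>\<^bsub>MR\<^esub> B \<otimes>\<^bsub>MR\<^esub> C) (i, l) = (A \<otimes>\<^bsub>MR\<^esub> (B \<otimes>\<^bsub>MR\<^esub> C)) (i, l)" .
qed (intro mult_mem_carrier A B C)+

lemma matrix_ring_is_ring: "ring MR"
proof (rule ringI[OF matrix_abelian_group])
  show "monoid MR"
  proof (rule monoidI)
    fix A assume A: "A \<in> carrier MR"
    show "\<one>\<^bsub>MR\<^esub> \<otimes>\<^bsub>MR\<^esub> A = A"
    proof (rule matrix_eqI)
      fix i k assume ik: "i \<in> {1..n}" "k \<in> {1..n}"
      interpret abelian_group "M i k" using ik by (rule entry_abelian_group)
      have "(\<one>\<^bsub>MR\<^esub> \<otimes>\<^bsub>MR\<^esub> A) (i, k) = (\<Oplus>\<^bsub>M i k\<^esub>j\<in>{1..n}. if i = j then A (i, k) else \<zero>\<^bsub>M i k\<^esub>)"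
        unfolding mult_entry[OF ik]
        by (rule finsum_cong'[OF refl])
          (use ik A theta_one_left theta_zero_left entry_closed[OF A] in \<open>auto simp: one_entry\<close>)
      also have "\<dots> = A (i, k)"
        using ik entry_closed[OF A] by (intro finsum_singleton) auto
      finally show "(\<one>\<^bsub>MR\<^esub> \<otimes>\<^bsub>MR\<^esub> A) (i, k) = A (i, k)" .
    qed (intro mult_mem_carrier one_mem_carrier A)+
    show "A \<otimes>\<^bsub>MR\<^esub> \<one>\<^bsub>MR\<^esub> = A"
    proof (rule matrix_eqI)
      fix i k assume ik: "i \<in> {1..n}" "k \<in> {1..n}"
      interpret abelian_group "M i k" using ik by (rule entry_abelian_group)
      have "(A \<otimes>\<^bsub>MR\<^esub> \<one>\<^bsub>MR\<^esub>) (i, k) = (\<Oplus>\<^bsub>M i k\<^esub>j\<in>{1..n}. if k = j then A (i, k) else \<zero>\<^bsub>M i k\<^esub>)"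
        unfolding mult_entry[OF ik]
        by (rule finsum_cong'[OF refl])
          (use ik A theta_one_right theta_zero_right entry_closed[OF A] in \<open>auto simp: one_entry\<close>)
      also have "\<dots> = A (i, k)"
        using ik entry_closed[OF A] by (intro finsum_singleton) auto
      finally show "(A \<otimes>\<^bsub>MR\<^esub> \<one>\<^bsub>MR\<^esub>) (i, k) = A (i, k)" .
    qed (intro mult_mem_carrier one_mem_carrier A)+
  qed (intro mult_mem_carrier one_mem_carrier matrix_mult_assoc; assumption)+
next
  fix A B C
  assume A: "A \<in> carrier MR" and B: "B \<in> carrier MR" and C: "C \<in> carrier MR"
  show "(A \<oplus>\<^bsub>MR\<^esub> B) \<otimes>\<^bsub>MR\<^esub> C = A \<otimes>\<^bsub>MR\<^esub> C \<oplus>\<^bsub>MR\<^esub> B \<otimes>\<^bsub>MR\<^esub> C"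
  proof (rule matrix_eqI)
    fix i k assume ik: "i \<in> {1..n}" "k \<in> {1..n}"
    interpret abelian_group "M i k" using ik by (rule entry_abelian_group)
    have "((A \<oplus>\<^bsub>MR\<^esub> B) \<otimes>\<^bsub>MR\<^esub> C) (i, k) = (\<Oplus>\<^bsub>M i k\<^esub>j\<in>{1..n}.
        \<theta> i j k (A (i, j)) (C (j, k)) \<oplus>\<^bsub>M i k\<^esub> \<theta> i j k (B (i, j)) (C (j, k)))"
      unfolding mult_entry[OF ik]
      by (rule finsum_cong'[OF refl])
        (use ik A B C summand_closed theta_add_left entry_closed in \<open>auto simp: add_entry\<close>)
    also have "\<dots> = (A \<otimes>\<^bsub>MR\<^esub> C \<oplus>\<^bsub>MR\<^esub> B \<otimes>\<^bsub>MR\<^esub> C) (i, k)"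
      unfolding add_entry[OF ik] mult_entry[OF ik]
      by (rule finsum_addf) (use ik A B C summand_closed in auto)
    finally show "((A \<oplus>\<^bsub>MR\<^esub> B) \<otimes>\<^bsub>MR\<^esub> C) (i, k) = (A \<otimes>\<^bsub>MR\<^esub> C \<oplus>\<^bsub>MR\<^esub> B \<otimes>\<^bsub>MR\<^esub> C) (i, k)" .
  qed (intro mult_mem_carrier add_mem_carrier A B C)+
  show "C \<otimes>\<^bsub>MR\<^esub> (A \<oplus>\<^bsub>MR\<^esub> B) = C \<otimes>\<^bsub>MR\<^esub> A \<oplus>\<^bsub>MR\<^esub> C \<otimes>\<^bsub>MR\<^esub> B"
  proof (rule matrix_eqI)
    fix i k assume ik: "i \<in> {1..n}" "k \<in> {1..n}"
    interpret abelian_group "M i k" using ik by (rule entry_abelian_group)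
    have "(C \<otimes>\<^bsub>MR\<^esub> (A \<oplus>\<^bsub>MR\<^esub> B)) (i, k) = (\<Oplus>\<^bsub>M i k\<^esub>j\<in>{1..n}.
        \<theta> i j k (C (i, j)) (A (j, k)) \<oplus>\<^bsub>M i k\<^esub> \<theta> i j k (C (i, j)) (B (j, k)))"
      unfolding mult_entry[OF ik]
      by (rule finsum_cong'[OF refl])
        (use ik A B C summand_closed theta_add_right entry_closed in \<open>auto simp: add_entry\<close>)
    also have "\<dots> = (C \<otimes>\<^bsub>MR\<^esub> A \<oplus>\<^bsub>MR\<^esub> C \<otimes>\<^bsub>MR\<^esub> B) (i, k)"
      unfolding add_entry[OF ik] mult_entry[OF ik]
      by (rule finsum_addf) (use ik A B C summand_closed in auto)
    finally show "(C \<otimes>\<^bsub>MR\<^esub> (A \<oplus>\<^bsub>MR\<^esub> B)) (i, k) = (C \<otimes>\<^bsub>MR\<^esub> A \<oplus>\<^bsub>MR\<^esub> C \<otimes>\<^bsub>MR\<^esub> B) (i, k)" .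
  qed (intro mult_mem_carrier add_mem_carrier A B C)+
qed

end

section \<open>The diagonal of a trivial generalized matrix ring\<close>

context trivial_generalized_matrix_ring
begin

sublocale MR: ring MR
  by (rule matrix_ring_is_ring)

abbreviation "DR \<equiv> diagonal_ring n M \<theta>"

definition "diag A = (\<lambda>(i, j)\<in>{1..n} \<times> {1..n}. if i = j then A (i, j) else \<zero>\<^bsub>M i j\<^esub>)"

lemma diag_entry:
  "\<lbrakk>i \<in> {1..n}; j \<in> {1..n}\<rbrakk> \<Longrightarrow> diag A (i, j) = (if i = j then A (i, j) else \<zero>\<^bsub>M i j\<^esub>)"
  by (simp add: diag_def)

lemma diag_mem_carrier: "A \<in> carrier MR \<Longrightarrow> diag A \<in> carrier MR"
  unfolding diag_def by (rule restrict_mem_carrier) (simp add: entry_closed entry_zero_closed)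

lemma carrier_diagonal_ring: "carrier DR = diag ` carrier MR"
proof -
  have "A = diag A" if "A \<in> carrier MR" "\<forall>i\<in>{1..n}. \<forall>j\<in>{1..n}. i \<noteq> j \<longrightarrow> A (i, j) = \<zero>\<^bsub>M i j\<^esub>" for A
    using that diag_mem_carrier by (intro matrix_eqI) (auto simp: diag_entry)
  then show ?thesis
    unfolding diagonal_ring_def using diag_mem_carrier by (auto simp: diag_entry)
qed

lemma diagonal_ring_simps:
  "mult DR = mult MR" "add DR = add MR" "one DR = one MR" "zero DR = zero MR"
  by (simp_all add: diagonal_ring_def)

text \<open>
  The other summands are \<open>\<theta> i j i (A (i, j)) (B (j, i))\<close> with \<open>j \<noteq> i\<close> and vanish in the class
  \<open>\<T>\<^sub>n\<close>. This is what makes the projection to the diagonal multiplicative.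
\<close>

lemma mult_diagonal_entry:
  assumes A: "A \<in> carrier MR" and B: "B \<in> carrier MR" and i: "i \<in> {1..n}"
  shows "(A \<otimes>\<^bsub>MR\<^esub> B) (i, i) = \<theta> i i i (A (i, i)) (B (i, i))"
proof -
  interpret abelian_group "M i i" using i i by (rule entry_abelian_group)
  have "(A \<otimes>\<^bsub>MR\<^esub> B) (i, i)
      = (\<Oplus>\<^bsub>M i i\<^esub>j\<in>{1..n}. if i = j then \<theta> i i i (A (i, i)) (B (i, i)) else \<zero>\<^bsub>M i i\<^esub>)"
    unfolding mult_entry[OF i i]
    by (rule finsum_cong'[OF refl])
      (use i summand_closed[OF A B i i i] theta_zero[OF i _ _ entry_closed[OF A i] entry_closed[OF B _ i]] in auto)
  also have "\<dots> = \<theta> i i i (A (i, i)) (B (i, i))"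
    using i summand_closed[OF A B i i i] by (intro finsum_singleton) auto
  finally show ?thesis .
qed

lemma diag_hom_mult:
  assumes A: "A \<in> carrier MR" and B: "B \<in> carrier MR"
  shows "diag (A \<otimes>\<^bsub>MR\<^esub> B) = diag A \<otimes>\<^bsub>MR\<^esub> diag B"
proof (rule matrix_eqI)
  fix i k assume i: "i \<in> {1..n}" and k: "k \<in> {1..n}"
  interpret abelian_group "M i k" using i k by (rule entry_abelian_group)
  note dA = diag_mem_carrier[OF A] and dB = diag_mem_carrier[OF B]
  show "diag (A \<otimes>\<^bsub>MR\<^esub> B) (i, k) = (diag A \<otimes>\<^bsub>MR\<^esub> diag B) (i, k)"
  proof (cases "i = k")
    case True
    then show ?thesis
      using mult_diagonal_entry[OF A B i] mult_diagonal_entry[OF dA dB i] i by (simp add: diag_entry)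
  next
    case False
    have "\<theta> i j k (diag A (i, j)) (diag B (j, k)) = \<zero>\<^bsub>M i k\<^esub>" if j: "j \<in> {1..n}" for j
      using False theta_zero_left[OF i j k entry_closed[OF dB j k]]
        theta_zero_right[OF i j k entry_closed[OF dA i j]] diag_entry[OF i j, of A] diag_entry[OF j k, of B]
      by (cases "i = j") auto
    then have "(diag A \<otimes>\<^bsub>MR\<^esub> diag B) (i, k) = (\<Oplus>\<^bsub>M i k\<^esub>j\<in>{1..n}. \<zero>\<^bsub>M i k\<^esub>)"
      unfolding mult_entry[OF i k] by (intro finsum_cong'[OF refl]) auto
    then show ?thesis using False diag_entry[OF i k] by simp
  qed
qed (intro diag_mem_carrier MR.m_closed A B)+

lemma diag_hom_add:
  assumes A: "A \<in> carrier MR" and B: "B \<in> carrier MR"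
  shows "diag (A \<oplus>\<^bsub>MR\<^esub> B) = diag A \<oplus>\<^bsub>MR\<^esub> diag B"
proof (rule matrix_eqI)
  fix i k assume ik: "i \<in> {1..n}" "k \<in> {1..n}"
  interpret abelian_group "M i k" using ik by (rule entry_abelian_group)
  show "diag (A \<oplus>\<^bsub>MR\<^esub> B) (i, k) = (diag A \<oplus>\<^bsub>MR\<^esub> diag B) (i, k)"
    unfolding diag_entry[OF ik] add_entry[OF ik] by simp
qed (intro diag_mem_carrier MR.a_closed A B)+

lemma diag_hom_one: "diag \<one>\<^bsub>MR\<^esub> = \<one>\<^bsub>MR\<^esub>"
  by (rule matrix_eqI) (auto simp: diag_entry one_entry intro!: diag_mem_carrier MR.one_closed)

lemma diagonal_subring: "subring (diag ` carrier MR) MR"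
proof (rule MR.subringI)
  have diag_zero: "diag \<zero>\<^bsub>MR\<^esub> = \<zero>\<^bsub>MR\<^esub>"
    by (rule matrix_eqI) (auto simp: diag_entry zero_entry intro!: diag_mem_carrier MR.zero_closed)
  fix B assume "B \<in> diag ` carrier MR"
  then obtain A where A: "A \<in> carrier MR" "B = diag A" by blast
  have "diag (\<ominus>\<^bsub>MR\<^esub> A) \<oplus>\<^bsub>MR\<^esub> diag A = \<zero>\<^bsub>MR\<^esub>"
    using A diag_hom_add[of "\<ominus>\<^bsub>MR\<^esub> A" A] by (simp add: diag_zero MR.l_neg)
  then have "\<ominus>\<^bsub>MR\<^esub> B = diag (\<ominus>\<^bsub>MR\<^esub> A)"
    unfolding A(2) using A(1) by (intro MR.minus_equality) (auto intro: diag_mem_carrier)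
  then show "\<ominus>\<^bsub>MR\<^esub> B \<in> diag ` carrier MR" using A(1) by simp
next
  show "\<one>\<^bsub>MR\<^esub> \<in> diag ` carrier MR"
    using diag_hom_one MR.one_closed by (metis imageI)
qed (auto simp: diag_mem_carrier simp flip: diag_hom_mult diag_hom_add)

lemma diag_ring_hom: "ring_hom_ring MR DR diag"
proof (rule ring_hom_ringI2[OF MR.ring_axioms])
  have "DR = MR\<lparr>carrier := diag ` carrier MR\<rparr>"
    unfolding carrier_diagonal_ring[symmetric] by (simp add: diagonal_ring_def)
  then show "ring DR" using MR.subring_is_ring[OF diagonal_subring] by simp
  show "diag \<in> ring_hom MR DR"
    by (rule ring_hom_memI)
      (simp_all add: carrier_diagonal_ring diagonal_ring_simps diag_hom_mult diag_hom_add diag_hom_one)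
qed

lemma kernel_diag:
  "a_kernel MR DR diag = {A \<in> carrier MR. \<forall>i\<in>{1..n}. A (i, i) = \<zero>\<^bsub>M i i\<^esub>}"
proof -
  have "diag A = \<zero>\<^bsub>MR\<^esub> \<longleftrightarrow> (\<forall>i\<in>{1..n}. A (i, i) = \<zero>\<^bsub>M i i\<^esub>)" if A: "A \<in> carrier MR" for A
  proof
    assume eq: "diag A = \<zero>\<^bsub>MR\<^esub>"
    show "\<forall>i\<in>{1..n}. A (i, i) = \<zero>\<^bsub>M i i\<^esub>"
    proof
      fix i assume "i \<in> {1..n}"
      then show "A (i, i) = \<zero>\<^bsub>M i i\<^esub>"
        using diag_entry[of i i A] zero_entry[of i i] by (simp add: eq)
    qed
  next
    assume "\<forall>i\<in>{1..n}. A (i, i) = \<zero>\<^bsub>M i i\<^esub>"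
    then show "diag A = \<zero>\<^bsub>MR\<^esub>"
      by (intro matrix_eqI diag_mem_carrier A MR.zero_closed) (simp add: diag_entry zero_entry)
  qed
  then show ?thesis by (auto simp: a_kernel_def' diagonal_ring_simps)
qed

text \<open>
  Multiplying \<open>k\<close> matrices with zero diagonal sums products \<open>m\<^sub>1 \<cdots> m\<^sub>k\<close> of entries along paths of \<open>k\<close>
  steps through the indices. A path that returns to an earlier index \<open>t\<close> contributes a factor
  \<open>\<theta> t j t\<close>, which is zero, so only paths without repetition survive, and these have fewer than \<open>n\<close> steps.
  
  To avoid a formal sum over paths, the product \<open>z\<close> of the entries read so far is recorded together
  with the set \<open>T\<close> of the indices visited before the current index \<open>b\<close>; the hypothesis on \<open>z\<close> says that
  \<open>z\<close> is annihilated by every return to \<open>T\<close>. One more step from \<open>b\<close> to a new index \<open>j\<close> preserves it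
  with \<open>insert b T\<close> in place of \<open>T\<close>. Thus the number of visited indices plus the number of remaining
  factors stays constant, and it suffices that this number is at least \<open>n\<close>.
\<close>

lemma zero_diagonal_path_product:
  assumes "set As \<subseteq> a_kernel MR DR diag"
    and T: "T \<subseteq> {1..n}" and a: "a \<in> {1..n}" and b: "b \<in> {1..n}" "b \<notin> T"
    and z: "z \<in> carrier (M a b)" and c: "c \<in> {1..n}"
    and avoid: "\<And>t y. \<lbrakk>t \<in> T; y \<in> carrier (M b t)\<rbrakk> \<Longrightarrow> \<theta> a b t z y = \<zero>\<^bsub>M a t\<^esub>"
    and len: "n \<le> card T + length As"
  shows "\<theta> a b c z (foldr (\<otimes>\<^bsub>MR\<^esub>) As \<one>\<^bsub>MR\<^esub> (b, c)) = \<zero>\<^bsub>M a c\<^esub>"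
  using assms(1) T b z avoid len
proof (induction As arbitrary: T b z)
  case Nil
  \<comment> \<open>All indices are visited, so no current index \<open>b \<notin> T\<close> is left.\<close>
  then have "T = {1..n}" by (intro card_seteq) auto
  with Nil show ?case by simp
next
  case (Cons A As)
  let ?X = "foldr (\<otimes>\<^bsub>MR\<^esub>) As \<one>\<^bsub>MR\<^esub>"
  note T = Cons.prems(2) and b = Cons.prems(3) and z = Cons.prems(5) and avoid = Cons.prems(6)
  have A: "A \<in> carrier MR" and A0: "A (b, b) = \<zero>\<^bsub>M b b\<^esub>" and As: "set As \<subseteq> a_kernel MR DR diag"
    using Cons.prems(1) b by (auto simp: kernel_diag)
  have X: "?X \<in> carrier MR"
    using As by (intro MR.foldr_mult_closed) (auto simp: kernel_diag)
  interpret ac: abelian_group "M a c" using a c by (rule entry_abelian_group)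
  have summand: "\<theta> a b c z (\<theta> b j c (A (b, j)) (?X (j, c))) = \<zero>\<^bsub>M a c\<^esub>" if j: "j \<in> {1..n}" for j
  proof -
    note Aj = entry_closed[OF A b j] and Xj = entry_closed[OF X j c]
    have eq: "\<theta> a b c z (\<theta> b j c (A (b, j)) (?X (j, c))) = \<theta> a j c (\<theta> a b j z (A (b, j))) (?X (j, c))"
      by (rule theta_assoc[OF a b j c z Aj Xj, symmetric])
    consider "j = b" | "j \<in> T" | "j \<noteq> b" "j \<notin> T" by blast
    then show ?thesis
    proof cases
      case 1
      then show ?thesis
        using A0 theta_zero_left[OF b b c] Xj theta_zero_right[OF a b c z] by simp
    next
      case 2
      then show ?thesis
        unfolding eq avoid[OF 2 Aj] by (intro theta_zero_left[OF a j c Xj])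
    next
      case 3
      have z': "\<theta> a b j z (A (b, j)) \<in> carrier (M a j)"
        by (rule theta_closed[OF a b j z Aj])
      have "card (insert b T) = Suc (card T)"
        using Cons.prems(4) finite_subset[OF T] by simp
      then have len': "n \<le> card (insert b T) + length As"
        using Cons.prems(7) by simp
      have avoid': "\<theta> a j t (\<theta> a b j z (A (b, j))) y = \<zero>\<^bsub>M a t\<^esub>"
        if t: "t \<in> insert b T" and y: "y \<in> carrier (M j t)" for t y
      proof -
        have t1: "t \<in> {1..n}" using t b T by auto
        have eq': "\<theta> a j t (\<theta> a b j z (A (b, j))) y = \<theta> a b t z (\<theta> b j t (A (b, j)) y)"
          by (rule theta_assoc[OF a b j t1 z Aj y])
        show ?thesis
        proof (cases "t = b")
          case True
          then have "\<theta> b j t (A (b, j)) y = \<zero>\<^bsub>M b t\<^esub>"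
            using theta_zero[OF b j _ Aj] y 3(1) by simp
          then show ?thesis
            unfolding eq' using theta_zero_right[OF a b t1 z] by simp
        next
          case False
          then show ?thesis
            unfolding eq' using t avoid theta_closed[OF b j t1 Aj y] by simp
        qed
      qed
      have "\<theta> a j c (\<theta> a b j z (A (b, j))) (?X (j, c)) = \<zero>\<^bsub>M a c\<^esub>"
        using Cons.IH[OF As _ j _ z' avoid' len'] T b 3 by simp
      with eq show ?thesis by simp
    qed
  qed
  have "\<theta> a b c z ((A \<otimes>\<^bsub>MR\<^esub> ?X) (b, c))
      = (\<Oplus>\<^bsub>M a c\<^esub>j\<in>{1..n}. \<theta> a b c z (\<theta> b j c (A (b, j)) (?X (j, c))))"
    unfolding mult_entry[OF b c]
    by (rule theta_finsum_right[OF a b c z]) (use summand_closed[OF A X b _ c] in auto)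
  also have "\<dots> = (\<Oplus>\<^bsub>M a c\<^esub>j\<in>{1..n}. \<zero>\<^bsub>M a c\<^esub>)"
    using summand by (intro ac.finsum_cong'[OF refl]) auto
  finally show ?case by simp
qed

lemma kernel_diag_nilpotent:
  assumes As: "set As \<subseteq> a_kernel MR DR diag" and "length As = n"
  shows "foldr (\<otimes>\<^bsub>MR\<^esub>) As \<one>\<^bsub>MR\<^esub> = \<zero>\<^bsub>MR\<^esub>"
proof (rule matrix_eqI)
  let ?X = "foldr (\<otimes>\<^bsub>MR\<^esub>) As \<one>\<^bsub>MR\<^esub>"
  show X: "?X \<in> carrier MR"
    using As by (intro MR.foldr_mult_closed) (auto simp: kernel_diag)
  fix i k assume i: "i \<in> {1..n}" and k: "k \<in> {1..n}"
  have "\<one>\<^bsub>M i i\<^esub> \<in> carrier (M i i)"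
    using diag_ring[OF i] by (simp add: ring_def monoid.one_closed)
  then have "\<theta> i i k \<one>\<^bsub>M i i\<^esub> (?X (i, k)) = \<zero>\<^bsub>M i k\<^esub>"
    \<comment> \<open>The path starts at \<open>i\<close> with the empty product 1 and no index visited before.\<close>
    by (intro zero_diagonal_path_product[OF As, of "{}"]) (use i k assms(2) in auto)
  then show "?X (i, k) = \<zero>\<^bsub>MR\<^esub> (i, k)"
    using theta_one_left[OF i k entry_closed[OF X i k]] zero_entry[OF i k] by simp
qed (rule MR.zero_closed)

lemma diag_nilpotent_extension: "nilpotent_extension MR DR diag n"
  using n_gt_1 kernel_diag_nilpotent carrier_diagonal_ring
  by (intro nilpotent_extension.intro diag_ring_hom nilpotent_extension_axioms.intro) auto

end

theorem corollary2p7: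
  fixes n :: nat
    and M :: "nat \<Rightarrow> nat \<Rightarrow> 'a ring"
    and \<theta> :: "nat \<Rightarrow> nat \<Rightarrow> nat \<Rightarrow> 'a \<Rightarrow> 'a \<Rightarrow> 'a"
  defines "R \<equiv> matrix_ring n M \<theta>"
    and "D \<equiv> diagonal_ring n M \<theta>"
  assumes "trivial_generalized_matrix_ring n M \<theta>"
  shows "(satisfies_PI D \<longleftrightarrow> satisfies_PI R) \<and>
    (cring D \<longrightarrow> (\<forall>x\<in>carrier R. \<forall>y\<in>carrier R.
        (x \<otimes>\<^bsub>R\<^esub> y \<ominus>\<^bsub>R\<^esub> y \<otimes>\<^bsub>R\<^esub> x) [^]\<^bsub>R\<^esub> n = \<zero>\<^bsub>R\<^esub>)) \<and>
    (almost_PI D \<longleftrightarrow> almost_PI R) \<and>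
    (intrinsically_PI D \<longrightarrow> intrinsically_PI R)"
proof -
  interpret nilpotent_extension R D "trivial_generalized_matrix_ring.diag n M" n
    unfolding R_def D_def
    using assms(3) by (rule trivial_generalized_matrix_ring.diag_nilpotent_extension)
  show ?thesis
    using satisfies_PI_iff commutator_pow_zero almost_PI_iff intrinsically_PI_lift by blast
qed

end
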